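(* Let $D\subseteq\mathbb{R}^d$ be open, $f:D\to\mathbb{R}^d$ locally Lipschitz, and $x^*\in D$ an equilibrium of $\dot x=f(x)$. Let $\varepsilon>0$ and let $S\subset D$ be compact with $B_\varepsilon(x^* )\subset\mathrm{int}(S)$. If $V(x)=\|x-x^*\|$ is an $\varepsilon$-Exponential Recurrent Lyapunov Function ($\varepsilon$-ERLF) over $S$ with parameters $(\alpha,\tau)$, $\alpha,\tau>0$, then $x^*$ is practically exponentially stable on $S$ with rate $\alpha$ and precision $$\varepsilon':=\varepsilon+F_\varepsilon\,h(\tau;L),$$ where $F_\varepsilon:=\sup_{x\in B_\varepsilon(x^* )}\|f(x)\|$, $L:=L_{\mathrm{cl}\,\mathcal{R}^\tau(B_\varepsilon(x^* ))}$ is the one-sided Lipschitz constant of $f$ over $\mathrm{cl}\,\mathcal{R}^\tau(B_\varepsilon(x^* ))$, and $h(\tau;L)=(e^{L\tau}-1)/L$ if $L\neq0$, $h(\tau;0)=\tau$.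
   Context: $\|\cdot\|$ is a fixed norm on $\mathbb{R}^d$ and $B_r(x)$ is the closed ball of radius $r$ around $x$. Locally Lipschitz means: for every compact $K\subset D$ there is $\overline L_K\ge 0$ with $\|f(y)-f(x)\|\le \overline L_K\|y-x\|$ for all $x,y\in K$. For $x\in D$, $\phi(t,x)$ is the solution of $\dot x=f(x)$ with $\phi(0,x)=x$, on its maximal open interval of existence $I(x)\ni 0$. Assertions about $\phi(t,x)$ for all $t\ge0$ include existence of the solution for all $t\ge0$. Weak pairing: the norm is equipped with an associated weak pairing $[\cdot;\cdot]:\mathbb{R}^d\times\mathbb{R}^d\to\mathbb{R}$, i.e. a map with (i) $[x_1+x_2;y]\le[x_1;y]+[x_2;y]$; (ii) $[\alpha x;y]=[x;\alpha y]=\alpha[x;y]$ for $\alpha>0$ and $[-x;-y]=[x;y]$; (iii) $[x;x]>0$ for $x\ne0$; (iv) $|[x;y]|\le[x;x]^{1/2}[y;y]^{1/2}$; such that $\|x\|=[x;x]^{1/2}$, and satisfying the curve norm derivative formula $\|x(t)\|\,D^+\|x(t)\|=[\dot x(t);x(t)]$ along differentiable curves, where $D^+\varphi(t)=\limsup_{h\to0^+}(\varphi(t+h)-\varphi(t))/h$. The one-sided Lipschitz constant of $f$ over a compact $K\subset D$ is the smallest $L_K\in\mathbb{R}$ with $[f(y)-f(x);y-x]\le L_K\|y-x\|^2$ for all $x,y\in K$. Reachable tube: $\mathcal{R}^\tau(A)=\{\phi(t,x): x\in A,\ t\in[0,\tau]\cap I(x)\}$. Containment times: $T_S(x;\tau):=\{t\in(0,\tau]: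 \phi(t,x)\in S\}$ (with $t\in I(x)$). An inequality $\min_{s\in T_S(x;\tau)}g(s)\le c$ means that there is $s\in T_S(x;\tau)$ with $g(s)\le c$. $\varepsilon$-ERLF: a continuous $V:D\to\mathbb{R}_{\ge0}$ is an $\varepsilon$-ERLF over $S$ with parameters $(\alpha,\tau)$ if (i) there are $a_1,a_2>0$ with $a_1\|x-x^*\|\le V(x)\le a_2\|x-x^*\|$ for all $x\in S$; (ii) $\min_{s\in T_S(x;\tau)}e^{\alpha s}V(\phi(s,x))\le V(x)$ for all $x\in K_\varepsilon:=\mathrm{cl}(S\setminus B_\varepsilon(x^* ))$. Practically exponentially stable on $S$ with rate $\alpha>0$ and precision $\varepsilon'$: there is $C\ge1$ such that for all $x\in S$ and all $t\ge0$, $\|\phi(t,x)-x^*\|\le\max\{\varepsilon',\,Ce^{-\alpha t}\|x-x^*\|\}$. *)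

theory Defs
  imports "HOL-Analysis.Analysis"
begin

text \<open>
  \<open>N\<close> is an arbitrary norm on \<open>real ^ 'd\<close>, not the Euclidean norm of the type. Compactness,
  closure, interior and derivatives refer to the topology of the type, which is the one
  induced by \<open>N\<close> since all norms on a finite-dimensional space are equivalent.
\<close>

definition is_norm :: "(real ^ 'd \<Rightarrow> real) \<Rightarrow> bool" where
  "is_norm N \<longleftrightarrow>
     (\<forall>x. 0 \<le> N x) \<and>
     (\<forall>x. N x = 0 \<longleftrightarrow> x = 0) \<and>
     (\<forall>c x. N (c *\<^sub>R x) = \<bar>c\<bar> * N x) \<and>
     (\<forall>x y. N (x + y) \<le> N x + N y)"

definition nball :: "(real ^ 'd \<Rightarrow> real) \<Rightarrow> real ^ 'd \<Rightarrow> real \<Rightarrow> (real ^ 'd) set" where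
  "nball N x r = {y. N (y - x) \<le> r}"

definition upper_right_Dini :: "(real \<Rightarrow> real) \<Rightarrow> real \<Rightarrow> ereal" where
  "upper_right_Dini \<phi> t = Limsup (at_right 0) (\<lambda>h. ereal ((\<phi> (t + h) - \<phi> t) / h))"

definition weak_pairing :: "(real ^ 'd \<Rightarrow> real ^ 'd \<Rightarrow> real) \<Rightarrow> bool" where
  "weak_pairing P \<longleftrightarrow>
     (\<forall>x1 x2 y. P (x1 + x2) y \<le> P x1 y + P x2 y) \<and>
     (\<forall>c x y. 0 < c \<longrightarrow> P (c *\<^sub>R x) y = c * P x y \<and> P x (c *\<^sub>R y) = c * P x y) \<and>
     (\<forall>x y. P (- x) (- y) = P x y) \<and>
     (\<forall>x. x \<noteq> 0 \<longrightarrow> 0 < P x x) \<and>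
     (\<forall>x y. \<bar>P x y\<bar> \<le> sqrt (P x x) * sqrt (P y y))"

definition curve_norm_derivative_formula ::
  "(real ^ 'd \<Rightarrow> real) \<Rightarrow> (real ^ 'd \<Rightarrow> real ^ 'd \<Rightarrow> real) \<Rightarrow> bool" where
  "curve_norm_derivative_formula N P \<longleftrightarrow>
     (\<forall>a b x x'. (\<forall>t\<in>{a<..<b}. (x has_vector_derivative x' t) (at t)) \<longrightarrow>
        (\<forall>t\<in>{a<..<b}.
           ereal (N (x t)) * upper_right_Dini (\<lambda>s. N (x s)) t = ereal (P (x' t) (x t))))"

definition associated_weak_pairing ::
  "(real ^ 'd \<Rightarrow> real) \<Rightarrow> (real ^ 'd \<Rightarrow> real ^ 'd \<Rightarrow> real) \<Rightarrow> bool" where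
  "associated_weak_pairing N P \<longleftrightarrow>
     weak_pairing P \<and> (\<forall>x. N x = sqrt (P x x)) \<and> curve_norm_derivative_formula N P"

definition locally_lipschitz ::
  "(real ^ 'd \<Rightarrow> real) \<Rightarrow> (real ^ 'd) set \<Rightarrow> (real ^ 'd \<Rightarrow> real ^ 'd) \<Rightarrow> bool" where
  "locally_lipschitz N D f \<longleftrightarrow>
     (\<forall>K. compact K \<and> K \<subseteq> D \<longrightarrow>
        (\<exists>M\<ge>0. \<forall>x\<in>K. \<forall>y\<in>K. N (f y - f x) \<le> M * N (y - x)))"

definition one_sided_lipschitz_const ::
  "(real ^ 'd \<Rightarrow> real) \<Rightarrow> (real ^ 'd \<Rightarrow> real ^ 'd \<Rightarrow> real) \<Rightarrow>
   (real ^ 'd \<Rightarrow> real ^ 'd) \<Rightarrow> (real ^ 'd) set \<Rightarrow> real" where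
  "one_sided_lipschitz_const N P f K =
     (LEAST L. \<forall>x\<in>K. \<forall>y\<in>K. P (f y - f x) (y - x) \<le> L * (N (y - x))\<^sup>2)"

definition is_solution ::
  "(real ^ 'd) set \<Rightarrow> (real ^ 'd \<Rightarrow> real ^ 'd) \<Rightarrow> real ^ 'd \<Rightarrow>
   (real \<Rightarrow> real ^ 'd) \<Rightarrow> real set \<Rightarrow> bool" where
  "is_solution D f x u J \<longleftrightarrow>
     open J \<and> is_interval J \<and> 0 \<in> J \<and> u 0 = x \<and>
     (\<forall>t\<in>J. u t \<in> D \<and> (u has_vector_derivative f (u t)) (at t))"

text \<open>
  For locally Lipschitz \<open>f\<close> any two solutions through \<open>x\<close> agree on the intersection of their
  intervals, so the union below is the maximal interval of existence and \<open>flow D f t x\<close> is the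
  value at \<open>t\<close> of the maximal solution. Outside \<open>existence_interval D f x\<close> the value of
  \<open>flow\<close> is meaningless; every use below is therefore guarded by membership of \<open>t\<close> in it.
\<close>

definition existence_interval ::
  "(real ^ 'd) set \<Rightarrow> (real ^ 'd \<Rightarrow> real ^ 'd) \<Rightarrow> real ^ 'd \<Rightarrow> real set" where
  "existence_interval D f x = \<Union>{J. \<exists>u. is_solution D f x u J}"

definition flow ::
  "(real ^ 'd) set \<Rightarrow> (real ^ 'd \<Rightarrow> real ^ 'd) \<Rightarrow> real \<Rightarrow> real ^ 'd \<Rightarrow> real ^ 'd" where
  "flow D f t x = (THE y. \<exists>u J. is_solution D f x u J \<and> t \<in> J \<and> y = u t)"

definition reachable_tube ::
  "(real ^ 'd) set \<Rightarrow> (real ^ 'd \<Rightarrow> real ^ 'd) \<Rightarrow> real \<Rightarrow> (real ^ 'd) set \<Rightarrow> (real ^ 'd) set" where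
  "reachable_tube D f \<tau> A =
     {flow D f t x | t x. x \<in> A \<and> t \<in> {0..\<tau>} \<inter> existence_interval D f x}"

definition containment_times ::
  "(real ^ 'd) set \<Rightarrow> (real ^ 'd \<Rightarrow> real ^ 'd) \<Rightarrow> (real ^ 'd) set \<Rightarrow> real ^ 'd \<Rightarrow> real \<Rightarrow> real set" where
  "containment_times D f S x \<tau> =
     {t \<in> {0<..\<tau>} \<inter> existence_interval D f x. flow D f t x \<in> S}"

definition ERLF ::
  "(real ^ 'd \<Rightarrow> real) \<Rightarrow> (real ^ 'd) set \<Rightarrow> (real ^ 'd \<Rightarrow> real ^ 'd) \<Rightarrow> real ^ 'd \<Rightarrow> real \<Rightarrow>
   (real ^ 'd) set \<Rightarrow> real \<Rightarrow> real \<Rightarrow> (real ^ 'd \<Rightarrow> real) \<Rightarrow> bool" where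
  "ERLF N D f xs \<epsilon> S \<alpha> \<tau> V \<longleftrightarrow>
     continuous_on D V \<and> (\<forall>x\<in>D. 0 \<le> V x) \<and>
     (\<exists>a1>0. \<exists>a2>0. \<forall>x\<in>S. a1 * N (x - xs) \<le> V x \<and> V x \<le> a2 * N (x - xs)) \<and>
     (\<forall>x\<in>closure (S - nball N xs \<epsilon>).
        \<exists>s\<in>containment_times D f S x \<tau>. exp (\<alpha> * s) * V (flow D f s x) \<le> V x)"

definition practically_exp_stable ::
  "(real ^ 'd \<Rightarrow> real) \<Rightarrow> (real ^ 'd) set \<Rightarrow> (real ^ 'd \<Rightarrow> real ^ 'd) \<Rightarrow> real ^ 'd \<Rightarrow>
   (real ^ 'd) set \<Rightarrow> real \<Rightarrow> real \<Rightarrow> bool" where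
  "practically_exp_stable N D f xs S \<alpha> \<epsilon>' \<longleftrightarrow>
     0 < \<alpha> \<and>
     (\<exists>C\<ge>1. \<forall>x\<in>S. \<forall>t\<ge>0. t \<in> existence_interval D f x \<and>
        N (flow D f t x - xs) \<le> max \<epsilon>' (C * exp (- \<alpha> * t) * N (x - xs)))"

definition growth_factor :: "real \<Rightarrow> real \<Rightarrow> real" where
  "growth_factor \<tau> L = (if L = 0 then \<tau> else (exp (L * \<tau>) - 1) / L)"

end

theory Submission
  imports Defs
begin

text \<open>
  Write \<open>V x = N (x - xs)\<close>. Every point of \<open>S\<close> returns to \<open>S\<close> after a positive time, so by
  compactness of \<open>S\<close> the flow exists on \<open>S\<close> for all positive times, and by Gronwall's inequality
  the tube of length \<open>\<tau>\<close> over \<open>S\<close> lies in a compact subset of \<open>D\<close>. Hence \<open>V\<close> is bounded by some \<open>G\<close>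
  on that tube and the one-sided Lipschitz constant \<open>L\<close> is a genuine minimum.

  Let \<open>a \<le> T\<close> be the last time at which the trajectory is in \<open>S\<close> and satisfies
  \<open>exp (\<alpha> a) V \<le> V x\<close>. If the point \<open>q\<close> reached there lies in the closure of \<open>S\<close> minus the
  \<open>\<epsilon>\<close>-ball, the next return time is beyond \<open>T\<close>, so \<open>T - a \<le> \<tau>\<close>, and \<open>V q \<ge> \<epsilon>\<close> turns the bound \<open>G\<close>
  into the exponential estimate with \<open>C = (G / \<epsilon>) exp (\<alpha> \<tau>)\<close>. Otherwise \<open>q\<close> is in the \<open>\<epsilon>\<close>-ball,
  and from then on each excursion out of the ball starts on its boundary and lasts at most \<open>\<tau>\<close>.
  Comparing the upper Dini derivative of \<open>N (flow D f t p - p)\<close> with the solution of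
  \<open>w' = L w + F\<close> shows that such an excursion moves by at most \<open>F h(\<tau>; L)\<close>.
\<close>

section \<open>Norms on finite-dimensional space\<close>

lemma is_normD:
  assumes "is_norm N"
  shows is_norm_nonneg: "0 \<le> N x" and is_norm_zero_iff: "N x = 0 \<longleftrightarrow> x = 0"
    and is_norm_scaleR: "N (c *\<^sub>R x) = \<bar>c\<bar> * N x" and is_norm_triangle: "N (x + y) \<le> N x + N y"
  using assms unfolding is_norm_def by auto

lemma is_norm_minus: "is_norm N \<Longrightarrow> N (- x) = N x"
  using is_norm_scaleR[of N "-1" x] by simp

lemma is_norm_triangle_diff:
  assumes "is_norm N" shows "\<bar>N x - N y\<bar> \<le> N (x - y)"
  using is_norm_triangle[OF assms, of "x - y" y] is_norm_triangle[OF assms, of "y - x" x]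
    is_norm_minus[OF assms, of "x - y"] by auto

text \<open>Expanding a vector in the standard basis and using subadditivity and homogeneity bounds
  \<open>N\<close> by the coordinates, each of which is at most the Euclidean norm. Together with
  \<open>norm_le_is_norm\<close> this transfers Lipschitz and compactness statements between the two
  norms.\<close>

lemma is_norm_le_norm:
  fixes N :: "real ^ 'd \<Rightarrow> real"
  assumes "is_norm N"
  obtains B where "B > 0" "\<And>x. N x \<le> B * norm x"
proof -
  define B where "B = (\<Sum>b\<in>(Basis :: (real ^ 'd) set). N b) + 1"
  have N0: "N 0 = 0" using is_norm_zero_iff[OF assms] by simp
  have *: "N (\<Sum>b\<in>A. c b *\<^sub>R b) \<le> (\<Sum>b\<in>A. \<bar>c b\<bar> * N b)" if "finite A" for A and c :: "real ^ 'd \<Rightarrow> real"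
    using that
  proof (induction A rule: finite_induct)
    case empty show ?case by (simp add: N0)
  next
    case (insert a A)
    then show ?case
      using is_norm_triangle[OF assms, of "c a *\<^sub>R a" "\<Sum>b\<in>A. c b *\<^sub>R b"]
      by (simp add: is_norm_scaleR[OF assms])
  qed
  have "N x \<le> B * norm x" for x
  proof -
    have "N x \<le> (\<Sum>b\<in>Basis. \<bar>x \<bullet> b\<bar> * N b)"
      using *[of Basis "\<lambda>b. x \<bullet> b"] by (simp add: euclidean_representation)
    also have "\<dots> \<le> (\<Sum>b\<in>Basis. norm x * N b)"
      by (intro sum_mono mult_right_mono Basis_le_norm is_norm_nonneg[OF assms])
    also have "\<dots> \<le> B * norm x"
      by (simp add: B_def distrib_right flip: sum_distrib_left)
    finally show ?thesis .
  qed
  moreover have "B > 0"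
    using sum_nonneg[of "Basis :: (real ^ 'd) set" N] is_norm_nonneg[OF assms] by (simp add: B_def add_nonneg_pos)
  ultimately show ?thesis using that by blast
qed

lemma continuous_on_is_norm:
  fixes N :: "real ^ 'd \<Rightarrow> real"
  assumes "is_norm N"
  shows "continuous_on A N"
proof -
  obtain B where B: "B > 0" "\<And>x. N x \<le> B * norm x" using is_norm_le_norm[OF assms] by blast
  have "B-lipschitz_on A N"
    using B is_norm_triangle_diff[OF assms]
    by (intro lipschitz_onI) (auto simp: dist_norm intro: order_trans)
  then show ?thesis by (rule lipschitz_on_continuous_on)
qed

text \<open>By continuity \<open>N\<close> attains a minimum on the compact unit sphere.
  Definiteness makes this minimum positive, and homogeneity turns its reciprocal into the
  constant.\<close>

lemma norm_le_is_norm: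
  fixes N :: "real ^ 'd \<Rightarrow> real"
  assumes "is_norm N"
  obtains B where "B > 0" "\<And>x. norm x \<le> B * N x"
proof -
  obtain b :: "real ^ 'd" where "norm b = 1" using vector_choose_size[of 1] by auto
  then have "sphere 0 1 \<noteq> ({} :: (real ^ 'd) set)" by auto
  then obtain z :: "real ^ 'd" where z: "norm z = 1" "\<And>y. norm y = 1 \<Longrightarrow> N z \<le> N y"
    using continuous_attains_inf[OF compact_sphere _ continuous_on_is_norm[OF assms], of 0 1] by auto
  have pos: "N z > 0"
    using is_norm_nonneg[OF assms, of z] is_norm_zero_iff[OF assms, of z] z(1) by fastforce
  have "norm x \<le> (1 / N z) * N x" for x
  proof (cases "x = 0")
    case True then show ?thesis using is_norm_zero_iff[OF assms, of x] by simp
  next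
    case False
    then have "N z \<le> N ((1 / norm x) *\<^sub>R x)" by (intro z(2)) simp
    then show ?thesis using False pos by (simp add: is_norm_scaleR[OF assms] field_simps)
  qed
  then show ?thesis using that[of "1 / N z"] pos by simp
qed

lemma closed_nball: "is_norm N \<Longrightarrow> closed (nball N x r)"
  unfolding nball_def
  by (intro closed_Collect_le continuous_intros continuous_on_compose2[OF continuous_on_is_norm[of N UNIV]]) auto

lemma compact_nball:
  assumes "is_norm N" shows "compact (nball N x r)"
proof -
  obtain B where B: "B > 0" "\<And>x. norm x \<le> B * N x" using norm_le_is_norm[OF assms] by blast
  have "nball N x r \<subseteq> cball x (B * r)"
    using B by (auto simp: nball_def dist_norm norm_minus_commute) (smt (verit) mult_left_mono)
  then show ?thesis
    using closed_nball[OF assms] bounded_subset[OF bounded_cball] by (auto simp: compact_eq_bounded_closed)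
qed

section \<open>Ordinary differential equations with Lipschitz right-hand side\<close>

text \<open>Gronwall's inequality in both time directions. The squared norm is differentiable even
  where \<open>w\<close> vanishes, and its derivative is at most \<open>2 * M\<close> times itself
  in absolute value, so the weights \<open>exp (- 2 * M * t)\<close> and
  \<open>exp (2 * M * t)\<close> make it nonincreasing and nondecreasing respectively.\<close>

lemma norm_growth_bounds:
  fixes w :: "real \<Rightarrow> 'a::real_inner"
  assumes "a \<le> b"
    and der: "\<And>t. t \<in> {a..b} \<Longrightarrow> (w has_vector_derivative w' t) (at t)"
    and bound: "\<And>t. t \<in> {a..b} \<Longrightarrow> norm (w' t) \<le> M * norm (w t)"
  shows "norm (w b) \<le> exp (M * (b - a)) * norm (w a)"
    and "norm (w a) \<le> exp (M * (b - a)) * norm (w b)"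
proof -
  define g where "g \<sigma> t = exp (\<sigma> * 2 * M * t) * (w t \<bullet> w t)" for \<sigma> t
  define g' where "g' \<sigma> t = exp (\<sigma> * 2 * M * t) * (2 * (w t \<bullet> w' t) + \<sigma> * 2 * M * (w t \<bullet> w t))" for \<sigma> t
  have g: "(g \<sigma> has_real_derivative g' \<sigma> t) (at t)" if "t \<in> {a..b}" for \<sigma> t
  proof -
    have "((\<lambda>t. w t \<bullet> w t) has_derivative (\<lambda>h. w t \<bullet> (h *\<^sub>R w' t) + (h *\<^sub>R w' t) \<bullet> w t)) (at t)"
      using der[OF that] unfolding has_vector_derivative_def by (intro has_derivative_inner)
    then have "((\<lambda>t. w t \<bullet> w t) has_real_derivative 2 * (w t \<bullet> w' t)) (at t)"
      by (rule has_derivative_imp_has_field_derivative) (auto simp: inner_commute)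
    then show ?thesis unfolding g_def g'_def
      by (auto intro!: derivative_eq_intros simp: algebra_simps)
  qed
  have dot: "\<bar>w t \<bullet> w' t\<bar> \<le> M * (w t \<bullet> w t)" if "t \<in> {a..b}" for t
  proof -
    have "\<bar>w t \<bullet> w' t\<bar> \<le> norm (w t) * norm (w' t)" by (rule Cauchy_Schwarz_ineq2)
    also have "\<dots> \<le> norm (w t) * (M * norm (w t))" using bound[OF that] by (intro mult_left_mono) auto
    finally show ?thesis by (simp add: dot_square_norm power2_eq_square algebra_simps)
  qed
  have "g (-1) b \<le> g (-1) a"
  proof (rule DERIV_nonpos_imp_nonincreasing[OF \<open>a \<le> b\<close>])
    fix t assume "a \<le> t" "t \<le> b"
    then show "\<exists>y. (g (-1) has_real_derivative y) (at t) \<and> y \<le> 0"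
      using g[of t "-1"] dot[of t] unfolding g'_def
      by (intro exI[of _ "g' (-1) t"]) (auto simp: g'_def mult_le_0_iff)
  qed
  then have "exp (2 * M * a) * (norm (w b))\<^sup>2 \<le> exp (2 * M * b) * (norm (w a))\<^sup>2"
    by (simp add: g_def dot_square_norm exp_minus field_simps)
  then have "(norm (w b))\<^sup>2 \<le> exp (2 * M * b) / exp (2 * M * a) * (norm (w a))\<^sup>2"
    by (simp add: field_simps)
  also have "\<dots> = (exp (M * (b - a)) * norm (w a))\<^sup>2"
    by (simp add: power_mult_distrib exp_diff[symmetric] exp_double[symmetric] algebra_simps)
  finally show "norm (w b) \<le> exp (M * (b - a)) * norm (w a)"
    by (rule power2_le_imp_le) simp
  have "g 1 a \<le> g 1 b"
  proof (rule DERIV_nonneg_imp_nondecreasing[OF \<open>a \<le> b\<close>])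
    fix t assume "a \<le> t" "t \<le> b"
    then show "\<exists>y. (g 1 has_real_derivative y) (at t) \<and> 0 \<le> y"
      using g[of t 1] dot[of t] by (intro exI[of _ "g' 1 t"]) (auto simp: g'_def zero_le_mult_iff)
  qed
  then have "(norm (w a))\<^sup>2 \<le> exp (2 * M * b) / exp (2 * M * a) * (norm (w b))\<^sup>2"
    by (simp add: g_def dot_square_norm field_simps)
  also have "\<dots> = (exp (M * (b - a)) * norm (w b))\<^sup>2"
    by (simp add: power_mult_distrib exp_diff[symmetric] exp_double[symmetric] algebra_simps)
  finally show "norm (w a) \<le> exp (M * (b - a)) * norm (w b)"
    by (rule power2_le_imp_le) simp
qed

text \<open>Banach's fixed point theorem for the Picard operator on bounded continuous functions.
  The operator contains two integrals, each over an interval of length at most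
  \<open>2 * \<delta>\<close>, which gives the contraction factor
  \<open>4 * M * \<delta>\<close>.\<close>

lemma picard_lipschitz:
  fixes g :: "'a::euclidean_space \<Rightarrow> 'a"
  assumes lip: "M-lipschitz_on UNIV g" and "0 < \<delta>" and small: "4 * M * \<delta> < 1"
  obtains u where "u 0 = x"
    "\<And>t. t \<in> {-\<delta><..<\<delta>} \<Longrightarrow> (u has_vector_derivative g (u t)) (at t)"
proof -
  have M: "M \<ge> 0" using lipschitz_on_nonneg[OF lip] .
  \<comment> \<open>Integrating from \<open>-\<delta>\<close> rather than from \<open>0\<close> avoids oriented integrals.\<close>
  define F where "F u t = x + integral {-\<delta>..t} (\<lambda>s. g (u s)) - integral {-\<delta>..0} (\<lambda>s. g (u s))"
    for u and t :: real
  have gc: "continuous_on A (\<lambda>s. g (apply_bcontfun u s))" for A and u :: "real \<Rightarrow>\<^sub>C 'a"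
    by (intro continuous_on_compose2[OF lipschitz_on_continuous_on[OF lip]]) auto
  have gi: "(\<lambda>s. g (apply_bcontfun u s)) integrable_on {c..d}" for c d and u :: "real \<Rightarrow>\<^sub>C 'a"
    by (intro integrable_continuous_real gc)
  \<comment> \<open>The function space lives on the whole line, so the Picard iterate is extended
    constantly outside \<open>[-\<delta>, \<delta>]\<close> by clamping its argument.\<close>
  have "\<exists>v :: real \<Rightarrow>\<^sub>C 'a. \<forall>t. v t = F u (clamp (-\<delta>) \<delta> t)" for u :: "real \<Rightarrow>\<^sub>C 'a"
  proof -
    have "continuous_on (cbox (-\<delta>) \<delta>) (F u)"
      unfolding F_def cbox_interval
      by (intro continuous_intros indefinite_integral_continuous_1 gi)
    then show ?thesis using continuous_on_cbox_bcontfunE by metis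
  qed
  then obtain \<Phi> :: "(real \<Rightarrow>\<^sub>C 'a) \<Rightarrow> (real \<Rightarrow>\<^sub>C 'a)" where \<Phi>: "\<And>u t. \<Phi> u t = F u (clamp (-\<delta>) \<delta> t)"
    by metis
  have int_diff: "norm (integral {-\<delta>..t} (\<lambda>s. g (apply_bcontfun u s)) - integral {-\<delta>..t} (\<lambda>s. g (apply_bcontfun v s)))
      \<le> 2 * M * \<delta> * dist u v" if "t \<in> {-\<delta>..\<delta>}" for t and u v :: "real \<Rightarrow>\<^sub>C 'a"
  proof -
    have "norm (integral {-\<delta>..t} (\<lambda>s. g (apply_bcontfun u s) - g (apply_bcontfun v s)))
        \<le> (M * dist u v) * (t - (-\<delta>))"
    proof (rule integral_bound)
      fix s
      have "norm (g (apply_bcontfun u s) - g (apply_bcontfun v s)) \<le> M * dist (u s) (v s)"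
        using lipschitz_onD[OF lip] by (simp add: dist_norm)
      also have "\<dots> \<le> M * dist u v" by (intro mult_left_mono dist_bounded M)
      finally show "norm (g (apply_bcontfun u s) - g (apply_bcontfun v s)) \<le> M * dist u v" .
    qed (use that in \<open>auto intro!: continuous_intros gc\<close>)
    also have "\<dots> \<le> (M * dist u v) * (2 * \<delta>)" using that M by (intro mult_left_mono) auto
    finally show ?thesis by (simp add: Henstock_Kurzweil_Integration.integral_diff[OF gi gi] algebra_simps)
  qed
  have "dist (\<Phi> u) (\<Phi> v) \<le> (4 * M * \<delta>) * dist u v" for u v
  proof (rule dist_bound)
    fix t
    define c where "c = clamp (-\<delta>) \<delta> t"
    have "c \<in> cbox (-\<delta>) \<delta>" unfolding c_def using \<open>0 < \<delta>\<close> by (intro clamp_in_interval) auto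
    then have c: "c \<in> {-\<delta>..\<delta>}" by auto
    let ?I = "\<lambda>w t. integral {-\<delta>..t} (\<lambda>s. g (apply_bcontfun w s))"
    have "dist (\<Phi> u t) (\<Phi> v t) = norm ((?I u c - ?I v c) - (?I u 0 - ?I v 0))"
      by (simp add: \<Phi> c_def[symmetric] F_def dist_norm algebra_simps)
    also have "\<dots> \<le> 2 * M * \<delta> * dist u v + 2 * M * \<delta> * dist u v"
      using int_diff[OF c, of u v] int_diff[of 0 u v] \<open>0 < \<delta>\<close>
      by (intro order_trans[OF norm_triangle_ineq4 add_mono]) auto
    finally have "dist (\<Phi> u t) (\<Phi> v t) \<le> 2 * M * \<delta> * dist u v + 2 * M * \<delta> * dist u v" .
    then show "dist (\<Phi> u t) (\<Phi> v t) \<le> (4 * M * \<delta>) * dist u v" by (simp add: algebra_simps)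
  qed
  moreover have "0 \<le> 4 * M * \<delta>" using M \<open>0 < \<delta>\<close> by simp
  ultimately obtain u where u: "\<Phi> u = u" using banach_fix_type[of "4 * M * \<delta>" \<Phi>] small by blast
  have ueq: "u t = F u t" if "t \<in> {-\<delta>..\<delta>}" for t
  proof -
    have "clamp (-\<delta>) \<delta> t = t" using that by (intro clamp_cancel_cbox) auto
    then show ?thesis using \<Phi>[of u t] u by simp
  qed
  show ?thesis
  proof (rule that[of "apply_bcontfun u"])
    show "u 0 = x" using ueq[of 0] \<open>0 < \<delta>\<close> by (simp add: F_def)
  next
    fix t assume t: "t \<in> {-\<delta><..<\<delta>}"
    have "(F u has_vector_derivative g (u t)) (at t within {-\<delta>..\<delta>})"
      unfolding F_def using t
      by (auto intro!: derivative_eq_intros integral_has_vector_derivative gc)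
    then have "(F u has_vector_derivative g (u t)) (at t)"
      using t by (simp add: at_within_Icc_at)
    then show "(apply_bcontfun u has_vector_derivative g (u t)) (at t)"
      by (rule has_vector_derivative_transform_within_open[OF _ open_greaterThanLessThan t]) (simp add: ueq)
  qed
qed

lemma is_interval_shift:
  fixes J :: "real set"
  assumes "is_interval J"
  shows "is_interval {t. s + t \<in> J}"
proof -
  have "t \<in> {t. s + t \<in> J}" if "a \<in> {t. s + t \<in> J}" "b \<in> {t. s + t \<in> J}" "a \<le> t" "t \<le> b" for a b t
    using mem_is_interval_1_I[OF assms, of "s + a" "s + b" "s + t"] that by auto
  then show ?thesis unfolding is_interval_1 by blast
qed

text \<open>The flow is studied in the Euclidean norm, for which derivatives and Lipschitz maps are
  available. The norm \<open>N\<close> enters only when displacements are measured.\<close>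

locale lipschitz_field =
  fixes D :: "(real ^ 'd) set" and f :: "real ^ 'd \<Rightarrow> real ^ 'd"
  assumes open_D: "open D"
    and lipschitz_compact:
      "\<And>K. compact K \<Longrightarrow> K \<subseteq> D \<Longrightarrow> \<exists>M\<ge>0. \<forall>x\<in>K. \<forall>y\<in>K. norm (f y - f x) \<le> M * norm (y - x)"
begin

lemma lipschitz_on_compact:
  assumes "compact K" "K \<subseteq> D"
  obtains M where "M-lipschitz_on K f"
proof -
  obtain M where "M \<ge> 0" "\<forall>x\<in>K. \<forall>y\<in>K. norm (f y - f x) \<le> M * norm (y - x)"
    using lipschitz_compact[OF assms] by blast
  then have "M-lipschitz_on K f" by (auto intro!: lipschitz_onI simp: dist_norm)
  then show ?thesis using that by blast
qed

lemma continuous_on_compact: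
  assumes "compact K" "K \<subseteq> D"
  shows "continuous_on K f"
  using lipschitz_on_compact[OF assms] lipschitz_on_continuous_on by blast

text \<open>One \<open>\<delta>\<close> serves all starting points near \<open>x0\<close>; this
  uniformity drives the limit argument for existence times. A solution for the globally Lipschitz
  extension solves the original equation as long as it stays in the closed ball, and the speed bound
  \<open>B\<close> keeps it there.\<close>

lemma local_existence:
  assumes "x0 \<in> D"
  obtains r \<delta> where "r > 0" "\<delta> > 0"
    "\<And>x. x \<in> ball x0 r \<Longrightarrow> \<exists>u. is_solution D f x u {-\<delta><..<\<delta>}"
proof -
  obtain e where e: "e > 0" "cball x0 e \<subseteq> D" using open_D assms open_contains_cball by blast
  define r where "r = e / 2"
  define K where "K = cball x0 e"
  have r: "r > 0" using e by (simp add: r_def)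
  have K: "compact K" "K \<subseteq> D" "convex K" "closed K" "K \<noteq> {}" using e by (auto simp: K_def)
  obtain M where M: "M-lipschitz_on K f" using lipschitz_on_compact[OF K(1,2)] .
  have "bounded (f ` K)"
    using K continuous_on_compact compact_continuous_image compact_imp_bounded by blast
  then obtain B where B: "B > 0" "\<And>y. y \<in> K \<Longrightarrow> norm (f y) \<le> B"
    unfolding bounded_pos by auto
  \<comment> \<open>The projection onto a ball is nonexpansive, so \<open>g\<close> extends \<open>f\<close> to a globally Lipschitz map.\<close>
  define g where "g y = f (closest_point K y)" for y
  have cp: "closest_point K y \<in> K" for y using closest_point_in_set K by blast
  have g: "M-lipschitz_on UNIV g"
  proof (rule lipschitz_onI)
    fix y z
    have "dist (g y) (g z) \<le> M * dist (closest_point K y) (closest_point K z)"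
      unfolding g_def using lipschitz_onD[OF M cp cp] .
    also have "\<dots> \<le> M * dist y z"
      by (intro mult_left_mono closest_point_lipschitz K lipschitz_on_nonneg[OF M])
    finally show "dist (g y) (g z) \<le> M * dist y z" .
  qed (rule lipschitz_on_nonneg[OF M])
  have M0: "M \<ge> 0" using lipschitz_on_nonneg[OF M] .
  \<comment> \<open>The first bound keeps the contraction factor below 1; the second keeps the
    solution within \<open>r\<close> of its starting point, hence within \<open>e = 2 * r\<close> of
    \<open>x0\<close>.\<close>
  define \<delta> where "\<delta> = min (1 / (8 * (M + 1))) (r / B)"
  have \<delta>: "\<delta> > 0" using r B M0 by (simp add: \<delta>_def)
  have "4 * M * \<delta> \<le> 4 * M * (1 / (8 * (M + 1)))" using M0 by (intro mult_left_mono) (auto simp: \<delta>_def)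
  also have "\<dots> < 1" using M0 by (simp add: field_simps)
  finally have small: "4 * M * \<delta> < 1" .
  have "\<exists>u. is_solution D f x u {-\<delta><..<\<delta>}" if x: "x \<in> ball x0 r" for x
  proof -
    obtain u where u: "u 0 = x"
      "\<And>t. t \<in> {-\<delta><..<\<delta>} \<Longrightarrow> (u has_vector_derivative g (u t)) (at t)"
      using picard_lipschitz[OF g \<delta> small] by blast
    have uK: "u t \<in> K" if t: "t \<in> {-\<delta><..<\<delta>}" for t
    proof -
      have "norm (u t - u 0) \<le> B * norm (t - 0)"
      proof (rule differentiable_bound[where f' = "\<lambda>t h. h *\<^sub>R g (u t)" and S = "{-\<delta><..<\<delta>}"])
        fix s assume s: "s \<in> {-\<delta><..<\<delta>}"
        then show "(u has_derivative (\<lambda>h. h *\<^sub>R g (u s))) (at s within {-\<delta><..<\<delta>})"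
          using u(2)[OF s] by (auto simp: has_vector_derivative_def intro: has_derivative_at_withinI)
        show "onorm (\<lambda>h. h *\<^sub>R g (u s)) \<le> B"
          by (intro onorm_le) (simp add: g_def mult.commute[of B] mult_left_mono B cp)
      qed (use t \<delta> in auto)
      also have "\<dots> \<le> B * (r / B)" using t B by (intro mult_left_mono) (auto simp: \<delta>_def)
      finally have "dist (u t) x \<le> r" using u(1) B(1) by (simp add: dist_norm)
      then have "dist x0 (u t) \<le> e"
        using x dist_triangle[of x0 "u t" x] by (auto simp: r_def dist_commute)
      then show ?thesis by (simp add: K_def)
    qed
    have "is_solution D f x u {-\<delta><..<\<delta>}"
      unfolding is_solution_def
    proof (intro conjI ballI)
      fix t assume t: "t \<in> {-\<delta><..<\<delta>}"
      show "u t \<in> D" using uK[OF t] K by blast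
      have "g (u t) = f (u t)" unfolding g_def using closest_point_self uK[OF t] by metis
      then show "(u has_vector_derivative f (u t)) (at t)" using u(2)[OF t] by simp
    qed (use \<delta> u(1) in auto)
    then show ?thesis by blast
  qed
  then show ?thesis using that r \<delta> by blast
qed

section \<open>Uniqueness, the maximal solution and the semigroup law\<close>

lemma is_solution_continuous_on:
  assumes "is_solution D f x u J" "A \<subseteq> J"
  shows "continuous_on A u"
proof -
  have "continuous (at t) u" if "t \<in> J" for t
    using assms(1) that has_vector_derivative_continuous unfolding is_solution_def by blast
  then show ?thesis using assms(2) by (auto intro!: continuous_at_imp_continuous_on)
qed

lemma is_solution_shift:
  assumes "is_solution D f x u J" "s \<in> J"
  shows "is_solution D f (u s) (\<lambda>t. u (s + t)) {t. s + t \<in> J}"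
  unfolding is_solution_def
proof (intro conjI ballI)
  have "{t. s + t \<in> J} = (\<lambda>t. s + t) -` J" by auto
  moreover have "open ((\<lambda>t. s + t) -` J)"
    using assms by (intro open_vimage) (auto simp: is_solution_def intro!: continuous_intros)
  ultimately show "open {t. s + t \<in> J}" by simp
  show "is_interval {t. s + t \<in> J}"
    using assms is_interval_shift by (auto simp: is_solution_def)
next
  fix t assume t: "t \<in> {t. s + t \<in> J}"
  then show "u (s + t) \<in> D" using assms by (auto simp: is_solution_def)
  have "(u has_vector_derivative f (u (s + t))) (at (s + t))"
    using assms t by (auto simp: is_solution_def)
  moreover have "((\<lambda>t. s + t) has_vector_derivative 1) (at t)"
    by (auto intro!: derivative_eq_intros)
  ultimately show "((\<lambda>t. u (s + t)) has_vector_derivative f (u (s + t))) (at t)"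
    using vector_diff_chain_at[of "\<lambda>t. s + t" 1 t u] by (simp add: o_def)
qed (use assms in auto)

text \<open>Between times 0 and \<open>t\<close> both solutions stay in one compact set, where
  \<open>f\<close> is Lipschitz. Their difference vanishes at 0, so the forward or the backward
  Gronwall bound, depending on the sign of \<open>t\<close>, makes it vanish at
  \<open>t\<close>.\<close>

lemma is_solution_unique:
  assumes u: "is_solution D f x u J" and v: "is_solution D f x v J'" and "t \<in> J" "t \<in> J'"
  shows "u t = v t"
proof -
  define a where "a = min 0 t"
  define b where "b = max 0 t"
  have ab: "a \<le> b" by (simp add: a_def b_def)
  have sub: "{a..b} \<subseteq> J" "{a..b} \<subseteq> J'"
    using u v assms(3,4) mem_is_interval_1_I[of J a b] mem_is_interval_1_I[of J' a b]
    by (auto simp: is_solution_def a_def b_def min_def max_def split: if_splits)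
  define K where "K = u ` {a..b} \<union> v ` {a..b}"
  have K: "compact K" "K \<subseteq> D"
    unfolding K_def using is_solution_continuous_on[OF u sub(1)] is_solution_continuous_on[OF v sub(2)] sub u v
    by (auto intro!: compact_Un compact_continuous_image simp: is_solution_def)
  obtain M where M: "M-lipschitz_on K f" using lipschitz_on_compact[OF K] .
  have der: "((\<lambda>t. u t - v t) has_vector_derivative f (u s) - f (v s)) (at s)" if "s \<in> {a..b}" for s
    using u v sub that by (auto simp: is_solution_def intro!: derivative_intros)
  have bd: "norm (f (u s) - f (v s)) \<le> M * norm (u s - v s)" if "s \<in> {a..b}" for s
    using lipschitz_onD[OF M, of "u s" "v s"] that by (auto simp: K_def dist_norm)
  have 0: "u 0 = v 0" using u v by (simp add: is_solution_def)
  show ?thesis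
    using norm_growth_bounds[of a b "\<lambda>t. u t - v t", OF ab der bd] 0
    by (cases "0 \<le> t") (auto simp: a_def b_def)
qed

text \<open>Uniqueness gives the definite description in \<open>flow\<close> its meaning.\<close>

lemma flow_eq:
  assumes "is_solution D f x u J" "t \<in> J"
  shows "flow D f t x = u t"
  unfolding flow_def using assms is_solution_unique by (intro the_equality) blast+

lemma existence_interval_superset:
  "is_solution D f x u J \<Longrightarrow> J \<subseteq> existence_interval D f x"
  unfolding existence_interval_def by blast

lemma existence_intervalE:
  assumes "t \<in> existence_interval D f x"
  obtains u J where "is_solution D f x u J" "t \<in> J"
  using assms unfolding existence_interval_def by blast

text \<open>All solution intervals contain 0, so their union is again an open interval; near each of
  its points the flow coincides with one particular solution.\<close>

lemma is_solution_flow: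
  assumes "x \<in> D"
  shows "is_solution D f x (\<lambda>t. flow D f t x) (existence_interval D f x)"
  unfolding is_solution_def
proof (intro conjI ballI)
  obtain r \<delta> where "r > 0" "\<delta> > 0" "\<And>y. y \<in> ball x r \<Longrightarrow> \<exists>u. is_solution D f y u {-\<delta><..<\<delta>}"
    by (metis local_existence[OF assms])
  then obtain u0 where u0: "is_solution D f x u0 {-\<delta><..<\<delta>}" by (metis centre_in_ball)
  show "0 \<in> existence_interval D f x"
    using existence_interval_superset[OF u0] \<open>\<delta> > 0\<close> by auto
  show "flow D f 0 x = x" using flow_eq[OF u0, of 0] u0 \<open>\<delta> > 0\<close> by (simp add: is_solution_def)
  show "open (existence_interval D f x)"
    unfolding existence_interval_def by (auto simp: is_solution_def)
  show "is_interval (existence_interval D f x)"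
    unfolding existence_interval_def is_interval_connected_1
    by (intro connected_Union) (auto simp: is_solution_def is_interval_connected_1)
next
  fix t assume "t \<in> existence_interval D f x"
  then obtain u J where u: "is_solution D f x u J" "t \<in> J" by (rule existence_intervalE)
  show "flow D f t x \<in> D" using flow_eq[OF u] u by (auto simp: is_solution_def)
  have "(u has_vector_derivative f (u t)) (at t)" "open J" using u by (auto simp: is_solution_def)
  then show "((\<lambda>t. flow D f t x) has_vector_derivative f (flow D f t x)) (at t)"
    unfolding flow_eq[OF u]
    by (rule has_vector_derivative_transform_within_open[OF _ _ u(2)]) (simp add: flow_eq[OF u(1)])
qed

lemma
  assumes "x \<in> D"
  shows zero_in_existence_interval: "0 \<in> existence_interval D f x"
    and flow_zero: "flow D f 0 x = x"
  using is_solution_flow[OF assms] by (auto simp: is_solution_def)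

lemma
  assumes "x \<in> D" "t \<in> existence_interval D f x"
  shows flow_in_D: "flow D f t x \<in> D"
    and flow_has_vector_derivative:
      "((\<lambda>t. flow D f t x) has_vector_derivative f (flow D f t x)) (at t)"
  using is_solution_flow[OF assms(1)] assms(2) by (auto simp: is_solution_def)

lemma existence_interval_between:
  assumes "x \<in> D" "b \<in> existence_interval D f x"
  shows "{0..b} \<subseteq> existence_interval D f x"
  using is_solution_flow[OF assms(1)] assms(2)
  by (auto simp: is_solution_def is_interval_1)

lemma continuous_on_flow:
  assumes "x \<in> D" "A \<subseteq> existence_interval D f x"
  shows "continuous_on A (\<lambda>t. flow D f t x)"
  using is_solution_continuous_on[OF is_solution_flow[OF assms(1)] assms(2)] .

text \<open>The solution through \<open>x\<close> is glued to the time-shifted solution through the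
  point reached at time \<open>s\<close>. The glued curve is a solution on the union of both
  intervals, which therefore lies in the maximal one.\<close>

lemma
  assumes x: "x \<in> D" and s: "s \<in> existence_interval D f x"
    and t: "t \<in> existence_interval D f (flow D f s x)"
  shows existence_interval_add: "s + t \<in> existence_interval D f x"
    and flow_add: "flow D f (s + t) x = flow D f t (flow D f s x)"
proof -
  define y where "y = flow D f s x"
  define J where "J = existence_interval D f x"
  \<comment> \<open>\<open>J'\<close> and \<open>v\<close> describe the maximal solution through
    \<open>y\<close>, shifted in time so that it passes through \<open>y\<close> at time
    \<open>s\<close>.\<close>
  define J' where "J' = {r. - s + r \<in> existence_interval D f y}"
  define v where "v r = flow D f (- s + r) y" for r
  have y: "y \<in> D" using flow_in_D[OF x s] by (simp add: y_def)
  have solx: "is_solution D f x (\<lambda>t. flow D f t x) J" using is_solution_flow[OF x] by (simp add: J_def)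
  have soly: "is_solution D f y (\<lambda>t. flow D f t y) (existence_interval D f y)" using is_solution_flow[OF y] .
  have agree: "v r = flow D f r x" if "r \<in> J" "r \<in> J'" for r
    using flow_eq[OF is_solution_shift[OF solx], of s "- s + r"] s that
    by (auto simp: J_def y_def v_def J'_def)
  have vd: "(v has_vector_derivative f (v r)) (at r)" "v r \<in> D" if "r \<in> J'" for r
  proof -
    have "((\<lambda>t. flow D f t y) has_vector_derivative f (flow D f (- s + r) y)) (at (- s + r))"
      using flow_has_vector_derivative[OF y] that by (simp add: J'_def)
    moreover have "((\<lambda>t. - s + t) has_vector_derivative 1) (at r)"
      by (auto intro!: derivative_eq_intros)
    ultimately show "(v has_vector_derivative f (v r)) (at r)"
      using vector_diff_chain_at[of "\<lambda>t. - s + t" 1 r "\<lambda>t. flow D f t y"] by (simp add: o_def v_def[abs_def])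
    show "v r \<in> D" using flow_in_D[OF y] that by (simp add: J'_def v_def)
  qed
  have "J' = (\<lambda>r. - s + r) -` existence_interval D f y" by (auto simp: J'_def)
  moreover have "open \<dots>"
    using soly by (intro open_vimage) (auto simp: is_solution_def intro!: continuous_intros)
  ultimately have oJ': "open J'" by simp
  have iJ': "is_interval J'"
    using soly is_interval_shift unfolding is_solution_def J'_def by blast
  have oJ: "open J" and iJ: "is_interval J" using solx by (auto simp: is_solution_def)
  have sJ: "s \<in> J \<inter> J'" using s zero_in_existence_interval[OF y] by (simp add: J_def J'_def)
  define w where "w r = (if r \<in> J then flow D f r x else v r)" for r
  have wv: "w r = v r" if "r \<in> J'" for r using agree that by (simp add: w_def)
  have "is_solution D f x w (J \<union> J')"
    unfolding is_solution_def
  proof (intro conjI ballI)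
    show "open (J \<union> J')" using oJ oJ' by auto
    show "is_interval (J \<union> J')"
      using iJ iJ' sJ unfolding is_interval_connected_1 by (intro connected_Un) auto
    show "0 \<in> J \<union> J'" "w 0 = x"
      using zero_in_existence_interval[OF x] flow_zero[OF x] by (auto simp: J_def w_def)
  next
    fix r assume r: "r \<in> J \<union> J'"
    show "w r \<in> D" using r flow_in_D[OF x] vd(2) by (auto simp: w_def J_def)
    show "(w has_vector_derivative f (w r)) (at r)"
    proof (cases "r \<in> J")
      case True
      then have "((\<lambda>t. flow D f t x) has_vector_derivative f (w r)) (at r)"
        using flow_has_vector_derivative[OF x] by (simp add: J_def w_def)
      then show ?thesis
        by (rule has_vector_derivative_transform_within_open[OF _ oJ True]) (simp add: w_def)
    next
      case False
      then have "r \<in> J'" using r by simp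
      then have "(v has_vector_derivative f (w r)) (at r)" using vd wv by simp
      then show ?thesis
        by (rule has_vector_derivative_transform_within_open[OF _ oJ' \<open>r \<in> J'\<close>]) (simp add: wv)
    qed
  qed
  moreover have st: "s + t \<in> J'" using t by (simp add: J'_def y_def)
  ultimately show "s + t \<in> existence_interval D f x" "flow D f (s + t) x = flow D f t (flow D f s x)"
    using existence_interval_superset[of x w "J \<union> J'"] flow_eq[of x w "J \<union> J'" "s + t"] wv[OF st]
    by (auto simp: v_def y_def)
qed

end

text \<open>If \<open>u\<close> exceeded \<open>w\<close> at \<open>t0\<close>, consider the last
  earlier time \<open>s\<close> with \<open>u s \<le> w s\<close>. Continuity forces equality there,
  and the strict derivative inequality puts \<open>u\<close> below \<open>w\<close> immediately
  after \<open>s\<close>, a contradiction.\<close>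

lemma Dini_comparison:
  assumes cont: "continuous_on {0..T} u"
    and der: "\<And>t. t \<in> {0..T} \<Longrightarrow> (w has_real_derivative w' t) (at t)"
    and init: "u 0 \<le> w 0"
    and Dini: "\<And>t. \<lbrakk>t \<in> {0..T}; u t = w t\<rbrakk> \<Longrightarrow> upper_right_Dini u t < ereal (w' t)"
    and "t0 \<in> {0..T}"
  shows "u t0 \<le> w t0"
proof (rule ccontr)
  assume "\<not> u t0 \<le> w t0"
  then have gt: "w t0 < u t0" by simp
  have contw: "continuous_on {0..T} w"
    using der DERIV_isCont by (intro continuous_at_imp_continuous_on) blast
  have contd: "continuous_on {0..t0} (\<lambda>t. u t - w t)"
    using \<open>t0 \<in> {0..T}\<close>
    by (intro continuous_on_diff continuous_on_subset[OF cont] continuous_on_subset[OF contw]) auto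
  define A where "A = {0..t0} \<inter> {t. u t - w t \<le> 0}"
  have "closed A"
    unfolding A_def using continuous_closed_preimage[OF contd closed_atLeastAtMost closed_atMost, of 0]
    by (simp add: vimage_def)
  moreover have ne: "A \<noteq> {}" "bdd_above A" using init \<open>t0 \<in> {0..T}\<close> by (auto simp: A_def)
  ultimately have "Sup A \<in> A" using closed_contains_Sup by blast
  define s where "s = Sup A"
  have s: "0 \<le> s" "s < t0" "u s \<le> w s" using \<open>Sup A \<in> A\<close> gt by (auto simp: A_def s_def less_le)
  have after: "w t < u t" if "s < t" "t \<le> t0" for t
    using cSup_upper[of t A] ne that s(1) by (force simp: A_def s_def)
  have "w s \<le> u s"
  proof (rule ccontr)
    assume "\<not> w s \<le> u s"
    then have "\<exists>x\<ge>s. x \<le> t0 \<and> u x - w x = 0"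
      using s gt by (intro IVT') (auto intro: continuous_on_subset[OF contd])
    then obtain x where "s \<le> x" "x \<le> t0" "u x = w x" by auto
    then show False using after[of x] \<open>\<not> w s \<le> u s\<close> by (cases "x = s") auto
  qed
  then have eq: "u s = w s" using s by simp
  have sT: "s \<in> {0..T}" using s \<open>t0 \<in> {0..T}\<close> by auto
  obtain c where c: "upper_right_Dini u s < ereal c" "c < w' s"
    using ereal_dense2[OF Dini[OF sT eq]] by auto
  have "eventually (\<lambda>h. ereal ((u (s + h) - u s) / h) < ereal c) (at_right 0)"
    using c(1) unfolding upper_right_Dini_def by (rule Limsup_lessD)
  moreover have "((\<lambda>h. (w (s + h) - w s) / h) \<longlongrightarrow> w' s) (at_right 0)"
    using der[OF sT] unfolding DERIV_def by (rule tendsto_mono[OF at_le, rotated]) auto 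
  then have "eventually (\<lambda>h. c < (w (s + h) - w s) / h) (at_right 0)"
    using c(2) by (rule order_tendstoD)
  moreover have "eventually (\<lambda>h::real. h \<in> {0<..<t0 - s}) (at_right 0)"
    using s by (intro eventually_at_rightI[of 0 "t0 - s"]) auto
  ultimately have "eventually (\<lambda>h::real. False) (at_right 0)"
  proof eventually_elim
    case (elim h)
    then have "(u (s + h) - u s) / h < (w (s + h) - w s) / h" by simp
    then have "u (s + h) < w (s + h)" using elim(3) eq by (simp add: divide_less_cancel)
    then show False using after[of "s + h"] elim(3) by auto
  qed
  then show False by simp
qed

section \<open>Forward completeness and compact bounds for tubes of trajectories\<close>

context lipschitz_field
begin

text \<open>Along a subsequence of times tending to \<open>T\<close> the states converge to some
  \<open>p\<close> in \<open>S\<close>. Solutions starting near \<open>p\<close> share a lifespan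
  \<open>\<delta>\<close> in both directions, so one started at a time close enough to
  \<open>T\<close> reaches \<open>T\<close>, whether \<open>T\<close> lies ahead or behind.\<close>

lemma existence_interval_limit:
  assumes x: "x \<in> D" and S: "compact S" "S \<subseteq> D"
    and A: "\<And>t. t \<in> A \<Longrightarrow> t \<in> existence_interval D f x \<and> flow D f t x \<in> S"
    and T: "T \<in> closure A"
  shows "T \<in> existence_interval D f x" "flow D f T x \<in> S"
proof -
  obtain t where t: "\<And>n. t n \<in> A" "t \<longlonglongrightarrow> T" using T unfolding closure_sequential by blast
  obtain p r where p: "p \<in> S" "strict_mono r" "(\<lambda>n. flow D f (t (r n)) x) \<longlonglongrightarrow> p"
    using S(1)[unfolded compact_def, rule_format, of "\<lambda>n. flow D f (t n) x"] A[OF t(1)]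
    by (auto simp: o_def)
  have "p \<in> D" using p(1) S(2) by blast
  have tr: "(\<lambda>n. t (r n)) \<longlonglongrightarrow> T" using LIMSEQ_subseq_LIMSEQ[OF t(2) p(2)] by (simp add: o_def)
  obtain \<rho> \<delta> where \<rho>: "\<rho> > 0" "\<delta> > 0" "\<And>y. y \<in> ball p \<rho> \<Longrightarrow> \<exists>u. is_solution D f y u {-\<delta><..<\<delta>}"
    by (metis local_existence[OF \<open>p \<in> D\<close>])
  have "eventually (\<lambda>n. dist (flow D f (t (r n)) x) p < \<rho> \<and> dist (t (r n)) T < \<delta>) sequentially"
    using tendstoD[OF p(3) \<rho>(1)] tendstoD[OF tr \<rho>(2)] by (rule eventually_conj)
  then obtain n where n: "dist (flow D f (t (r n)) x) p < \<rho>" "dist (t (r n)) T < \<delta>"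
    by (auto dest: eventually_happens)
  then obtain u where "is_solution D f (flow D f (t (r n)) x) u {-\<delta><..<\<delta>}"
    using \<rho>(3) by (metis dist_commute mem_ball)
  then have "T - t (r n) \<in> existence_interval D f (flow D f (t (r n)) x)"
    using existence_interval_superset n(2) by (force simp: dist_real_def)
  then have "t (r n) + (T - t (r n)) \<in> existence_interval D f x"
    using existence_interval_add[OF x] A[OF t(1)] by blast
  then show TI: "T \<in> existence_interval D f x" by simp
  have "isCont (\<lambda>t. flow D f t x) T"
    using flow_has_vector_derivative[OF x TI] has_vector_derivative_continuous by blast
  then have "(\<lambda>n. flow D f (t n) x) \<longlonglongrightarrow> flow D f T x" using t(2) isCont_tendsto_compose by blast
  then show "flow D f T x \<in> S"
    using closed_sequentially[OF compact_imp_closed[OF S(1)], of "\<lambda>n. flow D f (t n) x"] A[OF t(1)]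
    by auto
qed

text \<open>The return times may accumulate, so they are not enumerated: their supremum up to
  \<open>T\<close> is itself a return time by compactness of \<open>S\<close>.\<close>

lemma recurrent_imp_forward_complete:
  assumes S: "compact S" "S \<subseteq> D"
    and step: "\<And>y. y \<in> S \<Longrightarrow> \<exists>s>0. s \<in> existence_interval D f y \<and> flow D f s y \<in> S"
    and x: "x \<in> S" and "0 \<le> T"
  shows "T \<in> existence_interval D f x"
proof -
  have xD: "x \<in> D" using x S by blast
  define A where "A = {t \<in> {0..T} \<inter> existence_interval D f x. flow D f t x \<in> S}"
  have A: "A \<noteq> {}" "bdd_above A"
    using zero_in_existence_interval[OF xD] flow_zero[OF xD] x \<open>0 \<le> T\<close> by (auto simp: A_def)
  have sup: "Sup A \<in> existence_interval D f x" "flow D f (Sup A) x \<in> S"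
    using existence_interval_limit[OF xD S, of A "Sup A"] closure_contains_Sup[OF A]
    by (simp_all add: A_def)
  then obtain s where s: "s > 0" "s \<in> existence_interval D f (flow D f (Sup A) x)"
    "flow D f s (flow D f (Sup A) x) \<in> S" using step by blast
  have new: "Sup A + s \<in> existence_interval D f x" "flow D f (Sup A + s) x \<in> S"
    using existence_interval_add[OF xD sup(1) s(2)] flow_add[OF xD sup(1) s(2)] s(3) by auto
  have "0 \<le> Sup A"
    using A(2) zero_in_existence_interval[OF xD] flow_zero[OF xD] x \<open>0 \<le> T\<close>
    by (intro cSup_upper) (auto simp: A_def)
  have "T < Sup A + s"
  proof (rule ccontr)
    assume "\<not> T < Sup A + s"
    then have "Sup A + s \<in> A" using new \<open>0 \<le> Sup A\<close> s(1) by (auto simp: A_def)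
    then have "Sup A + s \<le> Sup A" using A(2) by (rule cSup_upper)
    then show False using s(1) by simp
  qed
  then show ?thesis using existence_interval_between[OF xD new(1)] \<open>0 \<le> T\<close> by auto
qed

text \<open>Continuity at time 0. This supplies a positive return time for points of the
  \<open>\<epsilon>\<close>-ball, on whose interior the decrease condition is silent.\<close>

lemma exists_flow_in_open:
  assumes p: "p \<in> D" and "open U" "p \<in> U" "0 < \<tau>"
  shows "\<exists>s\<in>{0<..\<tau>}. s \<in> existence_interval D f p \<and> flow D f s p \<in> U"
proof -
  have I: "open (existence_interval D f p)" "0 \<in> existence_interval D f p"
    using is_solution_flow[OF p] by (auto simp: is_solution_def)
  have "((\<lambda>t. flow D f t p) \<longlongrightarrow> flow D f 0 p) (at_right 0)"
    using has_vector_derivative_continuous[OF flow_has_vector_derivative[OF p I(2)]]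
    by (auto simp: continuous_within intro: tendsto_mono[OF at_le])
  then have "eventually (\<lambda>t. flow D f t p \<in> U) (at_right 0)"
    using assms by (intro topological_tendstoD) (auto simp: flow_zero)
  moreover have "eventually (\<lambda>t. t \<in> existence_interval D f p) (at_right 0)"
    using eventually_nhds_in_open[OF I] by (auto simp: eventually_at_filter elim: eventually_mono)
  moreover have "eventually (\<lambda>t. t \<in> {0<..<\<tau>}) (at_right 0)"
    using assms by (intro eventually_at_rightI[of 0 \<tau>]) auto
  ultimately have "eventually (\<lambda>s. s \<in> {0<..\<tau>} \<and> s \<in> existence_interval D f p \<and> flow D f s p \<in> U) (at_right 0)"
    by eventually_elim auto
  then show ?thesis by (metis (mono_tags, lifting) eventually_happens trivial_limit_at_right_real)
qed

text \<open>Quantitative dependence on the initial point: neighbouring trajectories stay in a closed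
  neighbourhood of the compact trajectory of \<open>x\<close>. Since the Lipschitz constant holds
  only inside this neighbourhood, Gronwall is applied up to the first time the distance reaches its
  radius.\<close>

lemma flow_nearby_compact:
  assumes x: "x \<in> D" "{0..T} \<subseteq> existence_interval D f x" and "0 \<le> T"
  obtains r K where "r > 0" "compact K" "K \<subseteq> D"
    "\<And>y t. \<lbrakk>y \<in> D; dist x y < r; {0..T} \<subseteq> existence_interval D f y; t \<in> {0..T}\<rbrakk> \<Longrightarrow> flow D f t y \<in> K"
proof -
  define C where "C = (\<lambda>t. flow D f t x) ` {0..T}"
  have C: "compact C" "C \<subseteq> D"
    unfolding C_def using continuous_on_flow[OF x] flow_in_D[OF x(1)] x(2)
    by (auto intro!: compact_continuous_image)
  obtain \<rho> where \<rho>: "\<rho> > 0" "(\<Union>c\<in>C. cball c \<rho>) \<subseteq> D"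
    using compact_subset_open_imp_cball_epsilon_subset[OF C(1) open_D C(2)] by blast
  define K where "K = (\<Union>c\<in>C. cball c \<rho>)"
  have K: "compact K" "K \<subseteq> D" using \<rho>(2) compact_minkowski_sum_cball[OF C(1)] by (auto simp: K_def)
  have memK: "z \<in> K" if "dist (flow D f t x) z \<le> \<rho>" "t \<in> {0..T}" for t z
    using that by (auto simp: K_def C_def)
  obtain M where M: "M-lipschitz_on K f" using lipschitz_on_compact[OF K] .
  have M0: "M \<ge> 0" using lipschitz_on_nonneg[OF M] .
  \<comment> \<open>Gronwall amplifies initial distances by at most \<open>exp (M * T)\<close>, so a
    distance below \<open>r\<close> stays below \<open>\<rho>\<close>.\<close>
  define r where "r = \<rho> * exp (- M * T)"
  have r: "r > 0" using \<rho> by (simp add: r_def)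
  have "flow D f t y \<in> K"
    if y: "y \<in> D" "dist x y < r" "{0..T} \<subseteq> existence_interval D f y" and t: "t \<in> {0..T}" for y t
  proof -
    define d where "d s = norm (flow D f s x - flow D f s y)" for s
    have dc: "continuous_on {0..T} d"
      unfolding d_def by (intro continuous_on_norm continuous_on_diff continuous_on_flow x y)
    have d0: "d 0 < r" using y x by (simp add: d_def flow_zero dist_norm)
    have "r \<le> \<rho>" using \<rho>(1) M0 \<open>0 \<le> T\<close> by (simp add: r_def)
    have "d t < \<rho>"
    proof (rule ccontr)
      assume "\<not> d t < \<rho>"
      define B where "B = {0..T} \<inter> {s. \<rho> \<le> d s}"
      have "closed B" unfolding B_def
        using continuous_closed_preimage[OF dc closed_atLeastAtMost closed_atLeast, of \<rho>]
        by (simp add: vimage_def)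
      moreover have B: "B \<noteq> {}" "bdd_below B" using t \<open>\<not> d t < \<rho>\<close> by (auto simp: B_def)
      ultimately have "Inf B \<in> B" using closed_contains_Inf by blast
      define b where "b = Inf B"
      have b: "0 \<le> b" "b \<le> T" "\<rho> \<le> d b" using \<open>Inf B \<in> B\<close> by (auto simp: B_def b_def)
      have small: "d s \<le> \<rho>" if s: "s \<in> {0..b}" for s
      proof (rule ccontr)
        assume "\<not> d s \<le> \<rho>"
        then obtain s' where s': "0 \<le> s'" "s' \<le> s" "d s' = \<rho>"
          using IVT'[of d 0 \<rho> s] d0 \<open>r \<le> \<rho>\<close> s b continuous_on_subset[OF dc, of "{0..s}"] by auto
        then have "s' \<in> B" using s b by (auto simp: B_def)
        then have "b \<le> s'" unfolding b_def using B(2) by (rule cInf_lower)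
        then have "s' = s" using s s' by auto
        then show False using s' \<open>\<not> d s \<le> \<rho>\<close> by simp
      qed
      have "d b \<le> exp (M * (b - 0)) * d 0"
        unfolding d_def
      proof (rule norm_growth_bounds(1)[where w = "\<lambda>s. flow D f s x - flow D f s y" and M = M and w' = "\<lambda>s. f (flow D f s x) - f (flow D f s y)"])
        fix s assume s: "s \<in> {0..b}"
        then have sT: "s \<in> {0..T}" using b by auto
        then have "s \<in> existence_interval D f x" "s \<in> existence_interval D f y" using x y by auto
        then show "((\<lambda>s. flow D f s x - flow D f s y) has_vector_derivative
            f (flow D f s x) - f (flow D f s y)) (at s)"
          using x y by (intro has_vector_derivative_diff flow_has_vector_derivative)
        have "flow D f s x \<in> K" "flow D f s y \<in> K"
          using memK[OF _ sT] small[OF s] \<rho>(1) by (auto simp: d_def dist_norm)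
        then show "norm (f (flow D f s x) - f (flow D f s y)) \<le> M * norm (flow D f s x - flow D f s y)"
          using lipschitz_onD[OF M] by (simp add: dist_norm)
      qed (rule b(1))
      also have "\<dots> \<le> exp (M * T) * d 0"
        using b M0 by (intro mult_right_mono) (auto simp: d_def mult_left_mono)
      also have "\<dots> < exp (M * T) * r" using d0 by simp
      also have "\<dots> = \<rho>" by (simp add: r_def exp_minus)
      finally show False using b by simp
    qed
    then show ?thesis using memK[OF _ t] by (simp add: d_def dist_norm)
  qed
  then show ?thesis using that r K by blast
qed

text \<open>Finitely many of the neighbourhoods from \<open>flow_nearby_compact\<close> cover
  \<open>S\<close>, and a finite union of compact sets is compact.\<close>

lemma flow_image_in_compact:
  assumes S: "compact S" "S \<subseteq> D"
    and ex: "\<And>x. x \<in> S \<Longrightarrow> {0..T} \<subseteq> existence_interval D f x" and "0 \<le> T"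
  obtains K where "compact K" "K \<subseteq> D" "\<And>x t. \<lbrakk>x \<in> S; t \<in> {0..T}\<rbrakk> \<Longrightarrow> flow D f t x \<in> K"
proof -
  have "\<exists>r K. r > 0 \<and> compact K \<and> K \<subseteq> D \<and> (\<forall>y\<in>S \<inter> ball x r. \<forall>t\<in>{0..T}. flow D f t y \<in> K)"
    if x: "x \<in> S" for x
  proof -
    have xD: "x \<in> D" using x S by blast
    obtain r K where "r > 0" "compact K" "K \<subseteq> D"
      "\<And>y t. \<lbrakk>y \<in> D; dist x y < r; {0..T} \<subseteq> existence_interval D f y; t \<in> {0..T}\<rbrakk> \<Longrightarrow> flow D f t y \<in> K"
      by (metis flow_nearby_compact[OF xD ex[OF x] \<open>0 \<le> T\<close>])
    then show ?thesis using ex S by (intro exI[of _ r] exI[of _ K]) auto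
  qed
  then obtain r K where rK: "\<And>x. x \<in> S \<Longrightarrow> r x > 0 \<and> compact (K x) \<and> K x \<subseteq> D \<and>
      (\<forall>y\<in>S \<inter> ball x (r x). \<forall>t\<in>{0..T}. flow D f t y \<in> K x)"
    by metis
  have cover: "S \<subseteq> (\<Union>x\<in>S. ball x (r x))" using rK by force
  obtain X where X: "X \<subseteq> S" "finite X" "S \<subseteq> (\<Union>x\<in>X. ball x (r x))"
    using compactE_image[OF S(1) open_ball cover] by blast
  show ?thesis
  proof (rule that[of "\<Union>x\<in>X. K x"])
    show "compact (\<Union>x\<in>X. K x)" using X rK by (intro compact_UN) auto
    show "(\<Union>x\<in>X. K x) \<subseteq> D" using X rK by blast
  next
    fix y t assume y: "y \<in> S" "t \<in> {0..T}"
    then obtain x where "x \<in> X" "y \<in> ball x (r x)" using X by blast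
    then show "flow D f t y \<in> (\<Union>x\<in>X. K x)" using rK X y by blast
  qed
qed

end

section \<open>Weak pairings and excursions\<close>

lemma weak_pairing_le:
  assumes "associated_weak_pairing N P"
  shows "P x y \<le> N x * N y"
  using assms unfolding associated_weak_pairing_def weak_pairing_def by (metis abs_le_D1)

text \<open>The admissible constants are exactly the upper bounds of the set \<open>Q\<close> of
  quotients. \<open>Q\<close> is nonempty because \<open>K\<close> has two distinct points and
  bounded because of the Cauchy-Schwarz property, so \<open>LEAST\<close> denotes
  \<open>Sup Q\<close>, which is itself admissible.\<close>

lemma one_sided_lipschitz_const_bound:
  assumes N: "is_norm N" and P: "associated_weak_pairing N P"
    and lip: "\<And>x y. x \<in> K \<Longrightarrow> y \<in> K \<Longrightarrow> N (f y - f x) \<le> M * N (y - x)"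
    and ne: "a \<in> K" "b \<in> K" "a \<noteq> b"
    and xy: "x \<in> K" "y \<in> K"
  shows "P (f y - f x) (y - x) \<le> one_sided_lipschitz_const N P f K * (N (y - x))\<^sup>2"
proof -
  define Q where "Q = {P (f y - f x) (y - x) / (N (y - x))\<^sup>2 | x y. x \<in> K \<and> y \<in> K \<and> x \<noteq> y}"
  have pos: "N (y - x) > 0" if "x \<noteq> y" for x y
    using is_norm_nonneg[OF N, of "y - x"] is_norm_zero_iff[OF N, of "y - x"] that by auto
  have P0: "P 0 0 \<le> 0" using weak_pairing_le[OF P, of 0 0] is_norm_zero_iff[OF N, of 0] by simp
  have N0: "N 0 = 0" using is_norm_zero_iff[OF N] by simp
  have iff: "(\<forall>x\<in>K. \<forall>y\<in>K. P (f y - f x) (y - x) \<le> L * (N (y - x))\<^sup>2) \<longleftrightarrow> (\<forall>q\<in>Q. q \<le> L)" for L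
  proof safe
    fix q assume *: "\<forall>x\<in>K. \<forall>y\<in>K. P (f y - f x) (y - x) \<le> L * (N (y - x))\<^sup>2" "q \<in> Q"
    then obtain x y where xy: "x \<in> K" "y \<in> K" "x \<noteq> y" "q = P (f y - f x) (y - x) / (N (y - x))\<^sup>2"
      unfolding Q_def by blast
    have "P (f y - f x) (y - x) \<le> L * (N (y - x))\<^sup>2" using * xy by blast
    then show "q \<le> L" using pos[OF xy(3)] xy(4) by (simp add: pos_divide_le_eq)
  next
    fix x y assume *: "\<forall>q\<in>Q. q \<le> L" "x \<in> K" "y \<in> K"
    show "P (f y - f x) (y - x) \<le> L * (N (y - x))\<^sup>2"
    proof (cases "x = y")
      case True then show ?thesis using P0 N0 by simp
    next
      case False
      then have "P (f y - f x) (y - x) / (N (y - x))\<^sup>2 \<in> Q" using * unfolding Q_def by blast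
      then have "P (f y - f x) (y - x) / (N (y - x))\<^sup>2 \<le> L" using * by blast
      then show ?thesis using pos[OF False] by (simp add: field_simps)
    qed
  qed
  have "\<forall>x\<in>K. \<forall>y\<in>K. P (f y - f x) (y - x) \<le> M * (N (y - x))\<^sup>2"
  proof (intro ballI)
    fix x y assume "x \<in> K" "y \<in> K"
    then have "N (f y - f x) * N (y - x) \<le> M * N (y - x) * N (y - x)"
      by (intro mult_right_mono lip is_norm_nonneg[OF N])
    then show "P (f y - f x) (y - x) \<le> M * (N (y - x))\<^sup>2"
      using weak_pairing_le[OF P, of "f y - f x" "y - x"] by (simp add: power2_eq_square mult.assoc)
  qed
  then have bdd: "bdd_above Q" unfolding iff by (auto simp: bdd_above_def)
  have "Q \<noteq> {}" using ne unfolding Q_def by blast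
  then have "one_sided_lipschitz_const N P f K = Sup Q"
    unfolding one_sided_lipschitz_const_def iff
    using bdd by (intro Least_equality) (auto intro: cSup_upper cSup_least)
  moreover have "\<forall>q\<in>Q. q \<le> Sup Q" using bdd by (auto intro: cSup_upper)
  ultimately show ?thesis using iff[of "Sup Q"] xy by simp
qed

text \<open>Valid for \<open>L = 0\<close> as well. With the derivative computed next, it shows that
  the growth factor solves \<open>h' = L * h + 1\<close>, \<open>h 0 = 0\<close>.\<close>

lemma exp_eq_growth_factor: "exp (L * t) = 1 + L * growth_factor t L"
  by (simp add: growth_factor_def)

lemma growth_factor_has_real_derivative:
  "((\<lambda>t. growth_factor t L) has_real_derivative exp (L * t)) (at t)"
proof (cases "L = 0")
  case True
  then show ?thesis by (simp add: growth_factor_def)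
next
  case False
  then show ?thesis by (auto simp: growth_factor_def intro!: derivative_eq_intros)
qed

lemma growth_factor_mono: "s \<le> t \<Longrightarrow> growth_factor s L \<le> growth_factor t L"
  using growth_factor_has_real_derivative[of L]
  by (intro DERIV_nonneg_imp_nondecreasing[of s t "\<lambda>t. growth_factor t L"]) (auto intro!: exI)

lemma growth_factor_0 [simp]: "growth_factor 0 L = 0"
  by (simp add: growth_factor_def)

text \<open>Let \<open>u\<close> be the distance from \<open>p\<close>. Splitting \<open>f\<close>
  along the trajectory into its increment from \<open>f p\<close> and \<open>f p\<close> itself, the
  curve norm derivative formula bounds \<open>u\<close> times its Dini derivative by
  \<open>L * u^2 + F * u\<close>. Dividing where \<open>u\<close> is positive leaves a linear
  differential inequality.\<close>

lemma (in lipschitz_field) flow_displacement_bound: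
  assumes N: "is_norm N" and P: "associated_weak_pairing N P"
    and p: "p \<in> D" "{0..T} \<subseteq> existence_interval D f p" and "0 \<le> T"
    and osl: "\<And>t. t \<in> {0..T} \<Longrightarrow>
      P (f (flow D f t p) - f p) (flow D f t p - p) \<le> L * (N (flow D f t p - p))\<^sup>2"
    and F: "N (f p) \<le> F"
  shows "N (flow D f T p - p) \<le> F * growth_factor T L"
proof -
  define u where "u t = N (flow D f t p - p)" for t
  define g where "g t = growth_factor t L" for t
  have g: "g 0 = 0" "\<And>t. t \<ge> 0 \<Longrightarrow> g t \<ge> 0"
    using growth_factor_mono[of 0 _ L] by (auto simp: g_def)
  have F0: "F \<ge> 0" using F is_norm_nonneg[OF N, of "f p"] by simp
  have Dini: "upper_right_Dini u t \<le> ereal (L * u t + F)" if t: "t \<in> {0..T}" "u t > 0" for t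
  proof -
    have I: "open (existence_interval D f p)" using is_solution_flow[OF p(1)] by (auto simp: is_solution_def)
    then obtain e where e: "e > 0" "ball t e \<subseteq> existence_interval D f p"
      using t p(2) open_contains_ball by blast
    have "((\<lambda>s. flow D f s p - p) has_vector_derivative f (flow D f s p)) (at s)"
      if "s \<in> {t - e<..<t + e}" for s
    proof -
      have "s \<in> existence_interval D f p" using that e(2) by (auto simp: dist_real_def subset_iff)
      then show ?thesis
        using has_vector_derivative_diff[OF flow_has_vector_derivative[OF p(1)] has_vector_derivative_const, of s p]
        by simp
    qed
    moreover have "curve_norm_derivative_formula N P" using P by (simp add: associated_weak_pairing_def)
    note this[unfolded curve_norm_derivative_formula_def, THEN spec, THEN spec, THEN spec, THEN spec,
        of "t - e" "t + e" "\<lambda>s. flow D f s p - p" "\<lambda>s. f (flow D f s p)"]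
    ultimately have "ereal (N (flow D f t p - p)) * upper_right_Dini (\<lambda>s. N (flow D f s p - p)) t =
        ereal (P (f (flow D f t p)) (flow D f t p - p))"
      using e(1) by simp
    then have eq: "ereal (u t) * upper_right_Dini u t = ereal (P (f (flow D f t p)) (flow D f t p - p))"
      by (simp add: u_def[abs_def])
    define z where "z = flow D f t p - p"
    have "P (f (flow D f t p)) z \<le> P (f (flow D f t p) - f p) z + P (f p) z"
      using P unfolding associated_weak_pairing_def weak_pairing_def by (metis diff_add_cancel)
    also have "\<dots> \<le> L * (u t)\<^sup>2 + N (f p) * u t"
      using osl[OF t(1)] weak_pairing_le[OF P, of "f p" z] by (simp add: z_def u_def add_mono)
    also have "\<dots> \<le> L * (u t)\<^sup>2 + F * u t" using F t(2) by simp
    finally have le: "P (f (flow D f t p)) z \<le> u t * (L * u t + F)"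
      by (simp add: power2_eq_square algebra_simps)
    show ?thesis
    \<comment> \<open>Infinite values are impossible: \<open>u t\<close> is positive and its product
      with the Dini derivative is finite.\<close>
    proof (cases "upper_right_Dini u t")
      case (real r)
      then have "u t * r \<le> u t * (L * u t + F)" using eq le by (simp add: z_def)
      then show ?thesis using real t(2) by (simp add: mult_le_cancel_left_pos)
    qed (use eq t(2) in auto)
  qed
  have cont: "continuous_on {0..T} u"
    unfolding u_def
    by (intro continuous_on_compose2[OF continuous_on_is_norm[OF N, of UNIV]] continuous_on_diff
        continuous_on_flow p continuous_on_const) auto
  have bound: "u T \<le> F * g T + \<eta> * (exp (L * T) + g T)" if \<eta>: "\<eta> > 0" for \<eta>
  proof -
    \<comment> \<open>This \<open>w\<close> solves \<open>w' = L * w + F + \<eta>\<close> with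
      \<open>w 0 = \<eta>\<close>. The perturbation makes the comparison strict and keeps
      \<open>w\<close> positive, so that \<open>u\<close> is positive wherever the two meet; finally
      \<open>\<eta>\<close> tends to 0.\<close>
    define w where "w t = \<eta> * exp (L * t) + (F + \<eta>) * g t" for t
    have wpos: "w t > 0" if "t \<ge> 0" for t
      unfolding w_def using \<eta> F0 g(2)[OF that] by (intro add_pos_nonneg) auto
    have "u T \<le> w T"
    proof (rule Dini_comparison[OF cont, of w "\<lambda>t. L * w t + (F + \<eta>)"])
      fix t
      have "(w has_real_derivative \<eta> * (L * exp (L * t)) + (F + \<eta>) * exp (L * t)) (at t)"
        unfolding w_def g_def
        by (auto intro!: derivative_eq_intros growth_factor_has_real_derivative)
      moreover have "\<eta> * (L * exp (L * t)) + (F + \<eta>) * exp (L * t) = L * w t + (F + \<eta>)"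
        unfolding w_def g_def exp_eq_growth_factor[of L t] by (simp add: algebra_simps)
      ultimately show "(w has_real_derivative L * w t + (F + \<eta>)) (at t)" by simp
    next
      show "u 0 \<le> w 0"
        using wpos[of 0] is_norm_zero_iff[OF N, of 0] by (simp add: u_def flow_zero[OF p(1)])
    next
      fix t assume t: "t \<in> {0..T}" "u t = w t"
      then have "upper_right_Dini u t \<le> ereal (L * u t + F)" using Dini[OF t(1)] wpos[of t] by auto
      also have "\<dots> < ereal (L * w t + (F + \<eta>))" using t \<eta> by simp
      finally show "upper_right_Dini u t < ereal (L * w t + (F + \<eta>))" .
    qed (use \<open>0 \<le> T\<close> in auto)
    then show ?thesis by (simp add: w_def algebra_simps)
  qed
  have "u T \<le> F * g T"
  proof (rule field_le_epsilon)
    fix e :: real assume "e > 0"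
    have c: "exp (L * T) + g T > 0" using g(2)[OF \<open>0 \<le> T\<close>] by (simp add: add_pos_nonneg)
    then show "u T \<le> F * g T + e" using bound[of "e / (exp (L * T) + g T)"] \<open>e > 0\<close> by simp
  qed
  then show ?thesis by (simp add: u_def g_def)
qed

lemma locally_lipschitz_imp_lipschitz_field:
  assumes N: "is_norm N" and "open D" and f: "locally_lipschitz N D f"
  shows "lipschitz_field D f"
proof
  fix K assume K: "compact K" "K \<subseteq> D"
  obtain M where M: "M \<ge> 0" "\<forall>x\<in>K. \<forall>y\<in>K. N (f y - f x) \<le> M * N (y - x)"
    using f K unfolding locally_lipschitz_def by blast
  obtain A where A: "A > 0" "\<And>x. N x \<le> A * norm x" using is_norm_le_norm[OF N] by blast
  obtain B where B: "B > 0" "\<And>x. norm x \<le> B * N x" using norm_le_is_norm[OF N] by blast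
  have "norm (f y - f x) \<le> B * M * A * norm (y - x)" if "x \<in> K" "y \<in> K" for x y
  proof -
    have "norm (f y - f x) \<le> B * N (f y - f x)" by (rule B)
    also have "\<dots> \<le> B * (M * (A * norm (y - x)))"
      using M A B that by (intro mult_left_mono order_trans[OF bspec[OF bspec[OF M(2)]]]) auto
    finally show ?thesis by (simp add: mult.assoc)
  qed
  moreover have "B * M * A \<ge> 0" using A B M by simp
  ultimately show "\<exists>M\<ge>0. \<forall>x\<in>K. \<forall>y\<in>K. norm (f y - f x) \<le> M * norm (y - x)" by blast
qed fact

text \<open>Pushing \<open>q\<close> slightly outwards along its ray from \<open>c\<close> leaves
  the ball but not \<open>S\<close>, because \<open>q\<close> is interior to \<open>S\<close>. This
  makes the decrease condition available where excursions from the ball begin.\<close>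

lemma nball_boundary_in_closure_diff:
  assumes N: "is_norm N" and sub: "nball N c \<epsilon> \<subseteq> interior S" and "\<epsilon> > 0" and q: "N (q - c) = \<epsilon>"
  shows "q \<in> closure (S - nball N c \<epsilon>)"
proof -
  have "((\<lambda>h. c + (1 + h) *\<^sub>R (q - c)) \<longlongrightarrow> c + (1 + 0) *\<^sub>R (q - c)) (at_right 0)"
    by (intro tendsto_intros)
  then have lim: "((\<lambda>h. c + (1 + h) *\<^sub>R (q - c)) \<longlongrightarrow> q) (at_right (0::real))" by simp
  have "q \<in> interior S" using sub q by (auto simp: nball_def)
  then have "eventually (\<lambda>h. c + (1 + h) *\<^sub>R (q - c) \<in> interior S) (at_right (0::real))"
    using topological_tendstoD[OF lim open_interior] by blast
  moreover have "eventually (\<lambda>h::real. h > 0) (at_right 0)" by (simp add: eventually_at_right_less)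
  ultimately have "eventually (\<lambda>h. c + (1 + h) *\<^sub>R (q - c) \<in> S - nball N c \<epsilon>) (at_right (0::real))"
  proof eventually_elim
    case (elim h)
    have "N ((1 + h) *\<^sub>R (q - c)) = (1 + h) * \<epsilon>"
      using elim(2) q by (simp only: is_norm_scaleR[OF N])
    then show ?case using elim \<open>\<epsilon> > 0\<close> interior_subset[of S] by (auto simp: nball_def)
  qed
  then have "eventually (\<lambda>h. c + (1 + h) *\<^sub>R (q - c) \<in> closure (S - nball N c \<epsilon>)) (at_right (0::real))"
    by (rule eventually_mono) (rule subsetD[OF closure_subset])
  then show ?thesis using Lim_in_closed_set[OF closed_closure _ _ lim] by simp
qed

section \<open>Practical exponential stability\<close>

theorem theorem7:
  fixes N :: "real ^ 'd \<Rightarrow> real"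
    and P :: "real ^ 'd \<Rightarrow> real ^ 'd \<Rightarrow> real"
    and D S :: "(real ^ 'd) set"
    and f :: "real ^ 'd \<Rightarrow> real ^ 'd"
    and xs :: "real ^ 'd"
    and \<epsilon> \<alpha> \<tau> :: real
  assumes "is_norm N" and "associated_weak_pairing N P"
    and "open D" and "locally_lipschitz N D f"
    and "xs \<in> D" and "f xs = 0"
    and "\<epsilon> > 0"
    and "compact S" and "S \<subseteq> D" and "nball N xs \<epsilon> \<subseteq> interior S"
    and "\<alpha> > 0" and "\<tau> > 0"
    and "ERLF N D f xs \<epsilon> S \<alpha> \<tau> (\<lambda>x. N (x - xs))"
  shows "practically_exp_stable N D f xs S \<alpha>
    (\<epsilon> + (SUP x\<in>nball N xs \<epsilon>. N (f x)) *
       growth_factor \<tau>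
         (one_sided_lipschitz_const N P f
            (closure (reachable_tube D f \<tau> (nball N xs \<epsilon>)))))"
proof -
  note N = assms(1) and P = assms(2) and S = assms(8,9) and BS = assms(10)
  interpret lipschitz_field D f
    using locally_lipschitz_imp_lipschitz_field[OF assms(1,3,4)] .
  define V where "V x = N (x - xs)" for x
  define B where "B = nball N xs \<epsilon>"
  define F where "F = (SUP x\<in>B. N (f x))"
  define L where "L = one_sided_lipschitz_const N P f (closure (reachable_tube D f \<tau> B))"
  define \<epsilon>' where "\<epsilon>' = \<epsilon> + F * growth_factor \<tau> L"
  have B_iff: "x \<in> B \<longleftrightarrow> V x \<le> \<epsilon>" for x by (simp add: B_def nball_def V_def)
  have Vcont: "continuous_on A V" for A
    unfolding V_def
    by (intro continuous_on_compose2[OF continuous_on_is_norm[OF N, of UNIV]] continuous_on_diff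
        continuous_on_id continuous_on_const) auto
  have BsubS: "B \<subseteq> S" and BsubD: "B \<subseteq> D" using BS interior_subset[of S] S by (auto simp: B_def)
  have xsB: "xs \<in> B" using \<open>\<epsilon> > 0\<close> is_norm_zero_iff[OF N, of 0] by (simp add: B_iff V_def)
  have recur: "\<exists>s\<in>{0<..\<tau>}. s \<in> existence_interval D f y \<and> flow D f s y \<in> S \<and> exp (\<alpha> * s) * V (flow D f s y) \<le> V y"
    if "y \<in> closure (S - B)" for y
  proof -
    have "\<exists>s\<in>containment_times D f S y \<tau>. exp (\<alpha> * s) * V (flow D f s y) \<le> V y"
      using assms(13) that unfolding ERLF_def B_def V_def by blast
    then show ?thesis unfolding containment_times_def by blast
  qed
  have boundary: "q \<in> closure (S - B)" if "V q = \<epsilon>" for q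
    using nball_boundary_in_closure_diff[OF N BS \<open>\<epsilon> > 0\<close>] that by (simp add: B_def V_def)
  have VK: "\<epsilon> \<le> V y" if "y \<in> closure (S - B)" for y
  proof -
    have "closed {y. \<epsilon> \<le> V y}" by (intro closed_Collect_le continuous_on_const Vcont)
    moreover have "S - B \<subseteq> {y. \<epsilon> \<le> V y}" by (auto simp: B_iff)
    ultimately have "closure (S - B) \<subseteq> {y. \<epsilon> \<le> V y}" by (intro closure_minimal)
    then show ?thesis using that by blast
  qed
  \<comment> \<open>Points outside the ball return to \<open>S\<close> by the decrease condition;
    points of the ball are interior to \<open>S\<close> and remain there for a short time.\<close>
  have ex: "T \<in> existence_interval D f x" if "x \<in> S" "0 \<le> T" for x T
  proof (rule recurrent_imp_forward_complete[OF S _ that])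
    fix y assume y: "y \<in> S"
    show "\<exists>s>0. s \<in> existence_interval D f y \<and> flow D f s y \<in> S"
    proof (cases "y \<in> B")
      case True
      then show ?thesis
        using exists_flow_in_open[of y "interior S" 1] interior_subset[of S] BS BsubD
        unfolding B_def by (metis greaterThanAtMost_iff open_interior subsetD zero_less_one)
    next
      case False
      then have "y \<in> closure (S - B)" using y closure_subset[of "S - B"] by blast
      then show ?thesis using recur[of y] by auto
    qed
  qed
  obtain K where K: "compact K" "K \<subseteq> D" "\<And>x t. x \<in> S \<Longrightarrow> t \<in> {0..\<tau>} \<Longrightarrow> flow D f t x \<in> K"
  proof -
    have "{0..\<tau>} \<subseteq> existence_interval D f x" if "x \<in> S" for x using ex that by auto
    then show ?thesis using flow_image_in_compact[OF S, of \<tau>] \<open>\<tau> > 0\<close> that by (metis less_imp_le)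
  qed

  \<comment> \<open>The tube over the ball and the constants \<open>L\<close> and
    \<open>F\<close>\<close>
  define R where "R = reachable_tube D f \<tau> B"
  have flowR: "flow D f t x \<in> R" if "x \<in> B" "t \<in> {0..\<tau>}" for x t
    unfolding R_def reachable_tube_def using that ex BsubS by fastforce
  have BR: "B \<subseteq> R" using flowR[of _ 0] flow_zero BsubD \<open>\<tau> > 0\<close> by fastforce
  have "R \<subseteq> K" unfolding R_def reachable_tube_def using K(3) BsubS by blast
  then have clR: "closure R \<subseteq> K" using K(1) by (simp add: closure_minimal compact_imp_closed)
  then have "compact (closure R)" using K(1) by (metis closed_closure compact_Int_closed inf.absorb2)
  then obtain M where M: "\<And>x y. x \<in> closure R \<Longrightarrow> y \<in> closure R \<Longrightarrow> N (f y - f x) \<le> M * N (y - x)"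
    using assms(4)[unfolded locally_lipschitz_def, rule_format, of "closure R"] order_trans[OF clR K(2)]
    by auto
  obtain b :: "real ^ 'd" where b: "b \<noteq> 0" using vector_choose_size[of 1] by (metis norm_zero zero_neq_one zero_le_one)
  \<comment> \<open>A point of the ball other than \<open>xs\<close>, so that the tube contains two
    distinct points, as the bound for the one-sided Lipschitz constant requires.\<close>
  define b' where "b' = xs + (\<epsilon> / N b) *\<^sub>R b"
  have Nb: "N b > 0" using is_norm_nonneg[OF N, of b] is_norm_zero_iff[OF N, of b] b by auto
  have b': "b' \<in> B" "xs \<noteq> b'"
    using Nb b \<open>\<epsilon> > 0\<close> by (auto simp: b'_def B_iff V_def is_norm_scaleR[OF N])
  have osl: "P (f y - f x) (y - x) \<le> L * (N (y - x))\<^sup>2" if "x \<in> R" "y \<in> R" for x y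
    unfolding L_def R_def[symmetric]
    by (rule one_sided_lipschitz_const_bound[where a = xs and b = b', OF N P M])
      (use that xsB b' BR closure_subset[of R] in auto)

  have Fle: "N (f x) \<le> F" if "x \<in> B" for x
  proof -
    have "compact ((\<lambda>x. N (f x)) ` B)"
      using compact_nball[OF N, of xs \<epsilon>] BsubD unfolding B_def
      by (intro compact_continuous_image continuous_on_compose2[OF continuous_on_is_norm[OF N, of UNIV]]
          continuous_on_compact) auto
    then show ?thesis
      unfolding F_def using that by (intro cSUP_upper bounded_imp_bdd_above compact_imp_bounded) auto
  qed
  have F0: "F \<ge> 0" using Fle[OF xsB] is_norm_nonneg[OF N, of "f xs"] by simp
  have h0: "growth_factor \<tau> L \<ge> 0" using growth_factor_mono[of 0 \<tau> L] \<open>\<tau> > 0\<close> by simp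
  have excursion: "V (flow D f t q) \<le> \<epsilon>'" if q: "q \<in> B" and t: "t \<in> {0..\<tau>}" for q t
  proof -
    have "N (flow D f t q - q) \<le> F * growth_factor t L"
    proof (rule flow_displacement_bound[OF N P])
      show "q \<in> D" using q BsubD by blast
      show "{0..t} \<subseteq> existence_interval D f q" using ex q BsubS by auto
      show "P (f (flow D f s q) - f q) (flow D f s q - q) \<le> L * (N (flow D f s q - q))\<^sup>2" if "s \<in> {0..t}" for s
        using osl[of q "flow D f s q"] flowR[of q s] BR q t that by auto
      show "N (f q) \<le> F" using Fle q by blast
    qed (use t in auto)
    also have "\<dots> \<le> F * growth_factor \<tau> L" using t F0 by (intro mult_left_mono growth_factor_mono) auto
    finally show ?thesis
      using is_norm_triangle[OF N, of "flow D f t q - q" "q - xs"] q by (simp add: V_def B_iff \<epsilon>'_def)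
  qed

  \<comment> \<open>Trajectories starting in the ball\<close>
  have flowcont: "continuous_on {0..T} (\<lambda>t. flow D f t x)" if "x \<in> S" for x T
    using ex that S by (intro continuous_on_flow) auto
  have Vflowcont: "continuous_on {0..T} (\<lambda>t. V (flow D f t x))" if "x \<in> S" for x T
    by (intro continuous_on_compose2[OF Vcont[of UNIV] flowcont[OF that]]) auto
  have add: "flow D f (s + t) x = flow D f t (flow D f s x)"
    if "x \<in> S" "flow D f s x \<in> S" "s \<ge> 0" "t \<ge> 0" for x s t
    using flow_add[of x s t] ex that S by blast

  have trapped: "V (flow D f T p) \<le> \<epsilon>'" if p: "p \<in> B" and T: "0 \<le> T" for p T
  proof (cases "V (flow D f T p) \<le> \<epsilon>")
    case True
    then show ?thesis using F0 h0 by (simp add: \<epsilon>'_def add_increasing2)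
  next
    case False
    have pS: "p \<in> S" using p BsubS by blast
    define A where "A = {0..T} \<inter> {t. V (flow D f t p) \<le> \<epsilon>}"
    have "closed A" unfolding A_def
      using continuous_closed_preimage[OF Vflowcont[OF pS] closed_atLeastAtMost closed_atMost, of T \<epsilon>]
      by (simp add: vimage_def)
    moreover have "0 \<in> A" using p T flow_zero[OF subsetD[OF BsubD p]] by (simp add: A_def B_iff)
    then have A: "A \<noteq> {}" "bdd_above A" by (auto simp: A_def)
    ultimately have "Sup A \<in> A" using closed_contains_Sup by blast
    \<comment> \<open>The last time up to \<open>T\<close> spent in the ball. There \<open>V\<close>
      equals \<open>\<epsilon>\<close> by continuity, so a return time \<open>s\<close> exists; the
      decrease puts the state at \<open>a + s\<close> back into the ball, which forces
      \<open>T < a + s\<close>. Hence the excursion up to \<open>T\<close> lasts at most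
      \<open>\<tau>\<close>.\<close>
    define a where "a = Sup A"
    have a: "0 \<le> a" "a \<le> T" "V (flow D f a p) \<le> \<epsilon>" using \<open>Sup A \<in> A\<close> by (auto simp: A_def a_def)
    have after: "\<epsilon> < V (flow D f t p)" if "a < t" "t \<le> T" for t
      using cSup_upper[of t A] A that a(1) by (force simp: A_def a_def)
    define q where "q = flow D f a p"
    have "V q = \<epsilon>"
    proof (rule ccontr)
      assume "V q \<noteq> \<epsilon>"
      then have "V q < \<epsilon>" using a by (simp add: q_def)
      then obtain t where "a \<le> t" "t \<le> T" "V (flow D f t p) = \<epsilon>"
        using IVT'[of "\<lambda>t. V (flow D f t p)" a \<epsilon> T] False a
          continuous_on_subset[OF Vflowcont[OF pS, of T], of "{a..T}"] by (auto simp: q_def)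
      then show False using after[of t] \<open>V q < \<epsilon>\<close> by (cases "t = a") (auto simp: q_def)
    qed
    then have qB: "q \<in> B" and qS: "q \<in> S" using BsubS by (auto simp: B_iff)
    obtain s where s: "s \<in> {0<..\<tau>}" "exp (\<alpha> * s) * V (flow D f s q) \<le> \<epsilon>"
      using recur[OF boundary[OF \<open>V q = \<epsilon>\<close>]] \<open>V q = \<epsilon>\<close> by auto
    have "V (flow D f s q) \<le> exp (\<alpha> * s) * V (flow D f s q)"
      using s(1) \<open>\<alpha> > 0\<close> is_norm_nonneg[OF N, of "flow D f s q - xs"]
      by (simp add: V_def mult_le_cancel_right1)
    then have "V (flow D f (a + s) p) \<le> \<epsilon>"
      using s add[OF pS, of a s] qS a(1) by (simp add: q_def)
    then have "T < a + s" using after[of "a + s"] s(1) by force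
    then have "V (flow D f (T - a) q) \<le> \<epsilon>'" using excursion[OF qB] a s(1) by auto
    then show ?thesis using add[OF pS, of a "T - a"] qS a by (simp add: q_def)
  qed

  \<comment> \<open>The exponential estimate on \<open>S\<close>\<close>
  obtain G where G: "G > 0" "\<And>x t. x \<in> S \<Longrightarrow> t \<in> {0..\<tau>} \<Longrightarrow> V (flow D f t x) \<le> G"
  proof -
    have "bounded (V ` K)" using K(1) Vcont compact_continuous_image compact_imp_bounded by blast
    then obtain G where "G > 0" "\<And>y. y \<in> K \<Longrightarrow> \<bar>V y\<bar> \<le> G" unfolding bounded_pos by auto
    then show ?thesis using that[of G] K(3) by (meson abs_le_D1)
  qed
  \<comment> \<open>The factor \<open>G / \<epsilon>\<close> replaces the bound \<open>G\<close> by
    a multiple of \<open>V q \<ge> \<epsilon>\<close>, and \<open>exp (\<alpha> * \<tau>)\<close>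
    pays for the time, at most \<open>\<tau>\<close>, between \<open>a\<close> and
    \<open>T\<close>.\<close>
  define C where "C = max 1 (G / \<epsilon> * exp (\<alpha> * \<tau>))"
  have "V (flow D f T x) \<le> max \<epsilon>' (C * exp (- \<alpha> * T) * V x)" if x: "x \<in> S" and T: "0 \<le> T" for x T
  proof -
    define A where "A = {t \<in> {0..T}. flow D f t x \<in> S \<and> exp (\<alpha> * t) * V (flow D f t x) \<le> V x}"
    have "closed A"
    proof -
      have "closed ({0..T} \<inter> (\<lambda>t. flow D f t x) -` S)"
        using flowcont[OF x] S(1) by (intro continuous_closed_preimage) (auto intro: compact_imp_closed)
      moreover have "closed ({0..T} \<inter> (\<lambda>t. exp (\<alpha> * t) * V (flow D f t x)) -` {..V x})"
        by (intro continuous_closed_preimage continuous_on_mult Vflowcont[OF x]) (auto intro!: continuous_intros)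
      ultimately have "closed (({0..T} \<inter> (\<lambda>t. flow D f t x) -` S) \<inter> ({0..T} \<inter> (\<lambda>t. exp (\<alpha> * t) * V (flow D f t x)) -` {..V x}))"
        by (rule closed_Int)
      moreover have "A = ({0..T} \<inter> (\<lambda>t. flow D f t x) -` S) \<inter> ({0..T} \<inter> (\<lambda>t. exp (\<alpha> * t) * V (flow D f t x)) -` {..V x})"
        by (auto simp: A_def)
      ultimately show ?thesis by simp
    qed
    moreover have "0 \<in> A" using x T S flow_zero by (auto simp: A_def subset_iff)
    then have A: "A \<noteq> {}" "bdd_above A" by (auto simp: A_def)
    ultimately have "Sup A \<in> A" using closed_contains_Sup by blast
    define a where "a = Sup A"
    define q where "q = flow D f a x"
    have a: "0 \<le> a" "a \<le> T" "q \<in> S" "exp (\<alpha> * a) * V q \<le> V x"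
      using \<open>Sup A \<in> A\<close> by (auto simp: A_def a_def q_def)
    have shift: "flow D f (a + t) x = flow D f t q" if "t \<ge> 0" for t
      using add[OF x, of a t] a that by (simp add: q_def)
    show ?thesis
    proof (cases "q \<in> closure (S - B)")
      case True
      then obtain s where s: "s \<in> {0<..\<tau>}" "flow D f s q \<in> S" "exp (\<alpha> * s) * V (flow D f s q) \<le> V q"
        using recur by blast
      have "exp (\<alpha> * (a + s)) * V (flow D f (a + s) x) = exp (\<alpha> * a) * (exp (\<alpha> * s) * V (flow D f s q))"
        using shift[of s] s(1) by (simp add: exp_add distrib_left)
      also have "\<dots> \<le> exp (\<alpha> * a) * V q" using s(3) by simp
      finally have "exp (\<alpha> * (a + s)) * V (flow D f (a + s) x) \<le> V x" using a(4) by simp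
      \<comment> \<open>The decrease after \<open>s\<close> multiplies with the one accumulated up
        to \<open>a\<close>, so \<open>a + s\<close> would be a later member of \<open>A\<close> if
        it did not exceed \<open>T\<close>.\<close>
      then have "a + s \<notin> A" using cSup_upper[of "a + s" A] A s(1) by (auto simp: a_def)
      then have "T < a + s"
        using \<open>exp (\<alpha> * (a + s)) * V (flow D f (a + s) x) \<le> V x\<close> s a shift[of s] by (auto simp: A_def)
      then have "V (flow D f T x) \<le> G" using G(2)[OF a(3), of "T - a"] shift[of "T - a"] a s(1) by auto
      also have "\<dots> \<le> G / \<epsilon> * V q" using VK[OF True] G(1) \<open>\<epsilon> > 0\<close> by (simp add: field_simps)
      also have "\<dots> \<le> G / \<epsilon> * (exp (- \<alpha> * a) * V x)"
        using a(4) G(1) \<open>\<epsilon> > 0\<close> by (intro mult_left_mono) (auto simp: exp_minus field_simps)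
      also have "\<dots> \<le> G / \<epsilon> * (exp (\<alpha> * \<tau> - \<alpha> * T) * V x)"
      proof -
        have "\<alpha> * T \<le> \<alpha> * (a + \<tau>)" using \<open>T < a + s\<close> s(1) \<open>\<alpha> > 0\<close> by (intro mult_left_mono) auto
        then show ?thesis
          using G(1) \<open>\<epsilon> > 0\<close> is_norm_nonneg[OF N]
          by (intro mult_left_mono mult_right_mono) (auto simp: V_def algebra_simps)
      qed
      also have "\<dots> = (G / \<epsilon> * exp (\<alpha> * \<tau>)) * exp (- \<alpha> * T) * V x"
        by (simp add: exp_diff exp_minus field_simps)
      also have "\<dots> \<le> C * exp (- \<alpha> * T) * V x"
        unfolding C_def using is_norm_nonneg[OF N] by (intro mult_right_mono) (auto simp: V_def)
      finally show ?thesis by simp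
    next
      case False
      then have "q \<in> B" using a(3) closure_subset[of "S - B"] by blast
      then have "V (flow D f (T - a) q) \<le> \<epsilon>'" using trapped a by simp
      then show ?thesis using shift[of "T - a"] a by simp
    qed
  qed
  then have "practically_exp_stable N D f xs S \<alpha> \<epsilon>'"
    unfolding practically_exp_stable_def using \<open>\<alpha> > 0\<close> ex
    by (auto simp: V_def C_def intro!: exI[of _ C])
  then show ?thesis by (simp add: \<epsilon>'_def F_def L_def B_def)
qed

end
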